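(* Let $\mathfrak g_{f,h,\alpha}=(\mathfrak g,\tilde g,I)$ be as defined in the context. If the defining data satisfies, for all $i=1,\dots,m$ and all $X_1,X_2,X_3\in\mathfrak a_r$, $$\alpha_i(X_1)h^i(X_2,X_3)-\alpha_i(X_2)h^i(X_1,X_3)=h^i(X_2,f(X_1,X_3))-h^i(X_1,f(X_2,X_3)),\qquad \alpha_i\wedge h_2^i=0,$$ then $\mathfrak g_{f,h,\alpha}$ is an almost Hermitian Lie algebra with integrable almost complex structure. Moreover, any two-step solvable SKT Lie algebra $(\mathfrak g,g,J)$ with $\mathfrak g'+J\mathfrak g'=\mathfrak g$ is isomorphic to some $\mathfrak g_{f,h,\alpha}$.
   Context: An almost Hermitian Lie algebra $(\mathfrak g,g,J)$ is a finite-dimensional real Lie algebra with an inner product $g$ and an endomorphism $J$, $J^2=-\mathrm{id}$, with $g(J\cdot,J\cdot)=g$; put $\sigma=g(J\cdot,\cdot)$. $J$ is integrable if $[JX,JY]-J[JX,Y]-J[X,JY]-[X,Y]=0$ for all $X,Y$. $(\mathfrak g,g,J)$ is SKT if $J$ is integrable and $d(J^*d\sigma)=0$, where $d$ is the Chevalley–Eilenberg differential and $(J^*\beta)(X_1,\dots,X_k)=\beta(JX_1,\dots,JX_k)$. $\mathfrak g'=[\mathfrak g,\mathfrak g]$; two-step solvable means $\mathfrak g'$ is Abelian. Isomorphisms preserve bracket, metric and almost complex structure. Definition of $\mathfrak g_{f,h,\alpha}$. Let $\mathfrak a_J$ be an $m$-dimensional complex vector space with basis $Y_1,\dots,Y_m$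 and $\mathfrak a_r$ a $k$-dimensional real vector space; let $U_r$ be a copy of $\mathfrak a_r$ and $I_0:\mathfrak a_r\to U_r$ a linear isomorphism. Let $f\in S^2\mathfrak a_r^*\otimes\mathfrak a_r$ be such that $(X,Y,Z)\mapsto f(f(X,Y),Z)$ is totally symmetric, let $h_1\in S^2\mathfrak a_r^*\otimes\mathfrak a_J$, $h_2\in\Lambda^2\mathfrak a_r^*\otimes\mathfrak a_J$, $\alpha=(\alpha_1,\dots,\alpha_m)$ with $\alpha_i\in\mathfrak a_r^*\otimes\mathbb C$, $g_0\in S^2\mathfrak a_r^*$ and $\tau_0\in\Lambda^2\mathfrak a_r^*$. Set $h=h_1+h_2=\sum_ih^iY_i$ and $h_2=\sum_ih_2^iY_i$ with complex-valued bilinear forms $h^i$, $h^i_2$ on $\mathfrak a_r$. As a vector space $\mathfrak g=\mathfrak a_J\oplus\mathfrak a_r\oplus U_r$, with anti-symmetric bilinear bracket determined by $$[Y_i,Y_j]=0,\quad [X,Y_i]=0,\quad [X,W]=0,\quad [I_0X,Y_i]=\alpha_i(X)Y_i,$$ $$[I_0X,W]=f(X,W)+h(X,W),\quad [I_0X,I_0W]=2i\,h_2(X,W)$$ for $X,W\in\mathfrak a_r$, extended complex-linearly in an argument in $\mathfrak a_J$. The almost complex structure is $I(Y+X+I_0Z)=iY-Z+I_0X$ for $Y\in\mathfrak a_J$, $X,Z\in\mathfrak a_r$. $\tilde g$ is an inner product on $\mathfrak g$ for which $Y_1,\dots,Y_m,iY_1,\dots,iY_m$ is an orthonormal basis of $\mathfrak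 a_J$, $\mathfrak a_r\oplus U_r\perp\mathfrak a_J$, and $\tilde g(X,W)=\tilde g(IX,IW)=g_0(X,W)$, $\tilde g(IX,W)=-\tilde g(X,IW)=\tau_0(X,W)$ for $X,W\in\mathfrak a_r$ (the data $g_0,\tau_0$ being such that $\tilde g$ is positive definite). *)

theory Defs
  imports "HOL-Analysis.Analysis"
begin

section \<open>Almost Hermitian Lie algebras\<close>

text \<open>
  All vector spaces are linear subspaces of an ambient real vector space, given as carrier sets;
  maps are total functions of which only the values on the carriers matter. In this way spaces of
  every finite dimension, including zero, occur inside a fixed type.
\<close>

definition fin_dim_space :: "'a::real_vector set \<Rightarrow> bool" where
  "fin_dim_space S \<longleftrightarrow> (\<exists>B. finite B \<and> span B = S)"

definition lin_on :: "'a::real_vector set \<Rightarrow> 'b::real_vector set \<Rightarrow> ('a \<Rightarrow> 'b) \<Rightarrow> bool" where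
  "lin_on S T p \<longleftrightarrow>
     (\<forall>x\<in>S. p x \<in> T) \<and>
     (\<forall>x\<in>S. \<forall>y\<in>S. p (x + y) = p x + p y) \<and>
     (\<forall>c. \<forall>x\<in>S. p (c *\<^sub>R x) = c *\<^sub>R p x)"

definition bilin_on ::
  "'a::real_vector set \<Rightarrow> 'b::real_vector set \<Rightarrow> 'c::real_vector set \<Rightarrow> ('a \<Rightarrow> 'b \<Rightarrow> 'c) \<Rightarrow> bool" where
  "bilin_on S T U b \<longleftrightarrow>
     (\<forall>x\<in>S. lin_on T U (b x)) \<and> (\<forall>y\<in>T. lin_on S U (\<lambda>x. b x y))"

definition symmetric_on :: "'a set \<Rightarrow> ('a \<Rightarrow> 'a \<Rightarrow> 'b) \<Rightarrow> bool" where
  "symmetric_on S b \<longleftrightarrow> (\<forall>x\<in>S. \<forall>y\<in>S. b x y = b y x)"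

definition antisymmetric_on :: "'a set \<Rightarrow> ('a \<Rightarrow> 'a \<Rightarrow> 'b::ab_group_add) \<Rightarrow> bool" where
  "antisymmetric_on S b \<longleftrightarrow> (\<forall>x\<in>S. \<forall>y\<in>S. b x y = - b y x)"

record 'a ah_struct =
  carr :: "'a set"
  brk :: "'a \<Rightarrow> 'a \<Rightarrow> 'a"
  met :: "'a \<Rightarrow> 'a \<Rightarrow> real"
  acs :: "'a \<Rightarrow> 'a"

definition lie_algebra_on :: "'a::real_vector set \<Rightarrow> ('a \<Rightarrow> 'a \<Rightarrow> 'a) \<Rightarrow> bool" where
  "lie_algebra_on G br \<longleftrightarrow>
     fin_dim_space G \<and> bilin_on G G G br \<and>
     (\<forall>x\<in>G. br x x = 0) \<and>
     (\<forall>x\<in>G. \<forall>y\<in>G. \<forall>z\<in>G. br x (br y z) + br y (br z x) + br z (br x y) = 0)"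

definition inner_product_on :: "'a::real_vector set \<Rightarrow> ('a \<Rightarrow> 'a \<Rightarrow> real) \<Rightarrow> bool" where
  "inner_product_on G g \<longleftrightarrow>
     bilin_on G G UNIV g \<and> symmetric_on G g \<and> (\<forall>x\<in>G. x \<noteq> 0 \<longrightarrow> g x x > 0)"

definition almost_hermitian :: "'a::real_vector ah_struct \<Rightarrow> bool" where
  "almost_hermitian L \<longleftrightarrow>
     lie_algebra_on (carr L) (brk L) \<and>
     inner_product_on (carr L) (met L) \<and>
     lin_on (carr L) (carr L) (acs L) \<and>
     (\<forall>x\<in>carr L. acs L (acs L x) = - x) \<and>
     (\<forall>x\<in>carr L. \<forall>y\<in>carr L. met L (acs L x) (acs L y) = met L x y)"

definition integrable_acs :: "'a::real_vector ah_struct \<Rightarrow> bool" where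
  "integrable_acs L \<longleftrightarrow>
     (\<forall>x\<in>carr L. \<forall>y\<in>carr L.
        brk L (acs L x) (acs L y) - acs L (brk L (acs L x) y) - acs L (brk L x (acs L y))
          - brk L x y = 0)"

text \<open>
  A \<open>k\<close>-form is a function on argument lists of length \<open>k\<close>. The differential is
  \<open>(d \<omega>)(x\<^sub>0,\<dots>,x\<^sub>k) = \<Sum>\<^sub>i\<^sub><\<^sub>j (-1)\<^sup>i\<^sup>+\<^sup>j \<omega>([x\<^sub>i,x\<^sub>j], x\<^sub>0,\<dots>,x\<^sub>k)\<close>, with
  \<open>x\<^sub>i\<close> and \<open>x\<^sub>j\<close> omitted among the trailing arguments.
\<close>

definition ce_diff :: "('a \<Rightarrow> 'a \<Rightarrow> 'a) \<Rightarrow> ('a list \<Rightarrow> real) \<Rightarrow> 'a list \<Rightarrow> real" where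
  "ce_diff br \<omega> xs =
     (\<Sum>j<length xs. \<Sum>i<j. (- 1) ^ (i + j) * \<omega> (br (xs ! i) (xs ! j) # nths xs (- {i, j})))"

definition acs_pull :: "('a \<Rightarrow> 'a) \<Rightarrow> ('a list \<Rightarrow> real) \<Rightarrow> 'a list \<Rightarrow> real" where
  "acs_pull J \<beta> xs = \<beta> (map J xs)"

definition fund_form :: "'a ah_struct \<Rightarrow> 'a list \<Rightarrow> real" where
  "fund_form L xs = met L (acs L (xs ! 0)) (xs ! 1)"

definition skt :: "'a::real_vector ah_struct \<Rightarrow> bool" where
  "skt L \<longleftrightarrow> almost_hermitian L \<and> integrable_acs L \<and>
     (\<forall>xs. length xs = 4 \<and> set xs \<subseteq> carr L \<longrightarrow>
        ce_diff (brk L) (acs_pull (acs L) (ce_diff (brk L) (fund_form L))) xs = 0)"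

definition derived_alg :: "'a::real_vector ah_struct \<Rightarrow> 'a set" where
  "derived_alg L = span {brk L x y |x y. x \<in> carr L \<and> y \<in> carr L}"

definition two_step_solvable :: "'a::real_vector ah_struct \<Rightarrow> bool" where
  "two_step_solvable L \<longleftrightarrow> (\<forall>x\<in>derived_alg L. \<forall>y\<in>derived_alg L. brk L x y = 0)"

definition ah_isomorphic :: "'a::real_vector ah_struct \<Rightarrow> 'b::real_vector ah_struct \<Rightarrow> bool" where
  "ah_isomorphic L M \<longleftrightarrow>
     (\<exists>\<phi>. bij_betw \<phi> (carr L) (carr M) \<and> lin_on (carr L) (carr M) \<phi> \<and>
        (\<forall>x\<in>carr L. \<forall>y\<in>carr L. \<phi> (brk L x y) = brk M (\<phi> x) (\<phi> y)) \<and>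
        (\<forall>x\<in>carr L. \<forall>y\<in>carr L. met M (\<phi> x) (\<phi> y) = met L x y) \<and>
        (\<forall>x\<in>carr L. \<phi> (acs L x) = acs M (\<phi> x)))"

section \<open>The almost Hermitian Lie algebras built from \<open>(f, h, \<alpha>)\<close>\<close>

text \<open>
  A complex vector space is a real one together with multiplication by \<open>\<i>\<close>, here \<open>mul_i\<close>.
  Indices \<open>1,\<dots>,m\<close> are shifted to \<open>0,\<dots>,m-1\<close>.
\<close>

record ('c, 'v) gfh_data =
  aJ :: "'c set"
  mul_i :: "'c \<Rightarrow> 'c"
  dimJ :: nat
  baseY :: "nat \<Rightarrow> 'c"
  ar :: "'v set"
  fmap :: "'v \<Rightarrow> 'v \<Rightarrow> 'v"
  hsym :: "'v \<Rightarrow> 'v \<Rightarrow> 'c"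
  halt :: "'v \<Rightarrow> 'v \<Rightarrow> 'c"
  alp :: "nat \<Rightarrow> 'v \<Rightarrow> complex"
  gzero :: "'v \<Rightarrow> 'v \<Rightarrow> real"
  tauzero :: "'v \<Rightarrow> 'v \<Rightarrow> real"

definition cscale :: "('c::real_vector, 'v) gfh_data \<Rightarrow> complex \<Rightarrow> 'c \<Rightarrow> 'c" where
  "cscale D c y = Re c *\<^sub>R y + Im c *\<^sub>R mul_i D y"

definition cexpansion :: "('c::real_vector, 'v) gfh_data \<Rightarrow> 'c \<Rightarrow> (nat \<Rightarrow> complex) \<Rightarrow> bool" where
  "cexpansion D y c \<longleftrightarrow>
     (\<forall>i\<ge>dimJ D. c i = 0) \<and> y = (\<Sum>i<dimJ D. cscale D (c i) (baseY D i))"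

definition complex_space_basis :: "('c::real_vector, 'v) gfh_data \<Rightarrow> bool" where
  "complex_space_basis D \<longleftrightarrow>
     subspace (aJ D) \<and> lin_on (aJ D) (aJ D) (mul_i D) \<and>
     (\<forall>y\<in>aJ D. mul_i D (mul_i D y) = - y) \<and>
     (\<forall>i<dimJ D. baseY D i \<in> aJ D) \<and> (\<forall>y\<in>aJ D. \<exists>!c. cexpansion D y c)"

definition coordJ :: "('c::real_vector, 'v) gfh_data \<Rightarrow> nat \<Rightarrow> 'c \<Rightarrow> complex" where
  "coordJ D i y = (THE c. cexpansion D y c) i"

definition hmap :: "('c::real_vector, 'v) gfh_data \<Rightarrow> 'v \<Rightarrow> 'v \<Rightarrow> 'c" where
  "hmap D x w = hsym D x w + halt D x w"

text \<open>
  The triple \<open>(y, x, z)\<close> stands for \<open>y + x + I\<^sub>0 z\<close>: the last factor is the copy \<open>U\<^sub>r\<close> of \<open>\<aa>\<^sub>r\<close>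
  and \<open>I\<^sub>0 z = (0, 0, z)\<close>. Bracket and metric are the (anti-)symmetric bilinear extensions of
  the defining relations; \<open>actJ z y\<close> is \<open>[I\<^sub>0 z, y]\<close> for \<open>y\<close> in \<open>\<aa>\<^sub>J\<close>.
\<close>

definition actJ :: "('c::real_vector, 'v) gfh_data \<Rightarrow> 'v \<Rightarrow> 'c \<Rightarrow> 'c" where
  "actJ D z y = (\<Sum>i<dimJ D. cscale D (alp D i z * coordJ D i y) (baseY D i))"

definition gfh_carr :: "('c::real_vector, 'v::real_vector) gfh_data \<Rightarrow> ('c \<times> 'v \<times> 'v) set" where
  "gfh_carr D = aJ D \<times> ar D \<times> ar D"

fun gfh_brk ::
  "('c::real_vector, 'v::real_vector) gfh_data \<Rightarrow> 'c \<times> 'v \<times> 'v \<Rightarrow> 'c \<times> 'v \<times> 'v \<Rightarrow> 'c \<times> 'v \<times> 'v" where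
  "gfh_brk D (y, x, z) (y', x', z') =
     (actJ D z y' - actJ D z' y + hmap D z x' - hmap D z' x + cscale D (2 * \<i>) (halt D z z'),
      fmap D z x' - fmap D z' x,
      0)"

fun gfh_met ::
  "('c::real_vector, 'v::real_vector) gfh_data \<Rightarrow> 'c \<times> 'v \<times> 'v \<Rightarrow> 'c \<times> 'v \<times> 'v \<Rightarrow> real" where
  "gfh_met D (y, x, z) (y', x', z') =
     (\<Sum>i<dimJ D. Re (coordJ D i y * cnj (coordJ D i y'))) +
     gzero D x x' + gzero D z z' + tauzero D z x' - tauzero D x z'"

fun gfh_acs ::
  "('c::real_vector, 'v::real_vector) gfh_data \<Rightarrow> 'c \<times> 'v \<times> 'v \<Rightarrow> 'c \<times> 'v \<times> 'v" where
  "gfh_acs D (y, x, z) = (mul_i D y, - z, x)"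

definition gfh :: "('c::real_vector, 'v::real_vector) gfh_data \<Rightarrow> ('c \<times> 'v \<times> 'v) ah_struct" where
  "gfh D = \<lparr>carr = gfh_carr D, brk = gfh_brk D, met = gfh_met D, acs = gfh_acs D\<rparr>"

text \<open>The two adjacent transpositions in the clause on \<open>f (f X Y) Z\<close> generate all permutations
  of \<open>(X, Y, Z)\<close>.\<close>

definition gfh_valid :: "('c::real_vector, 'v::real_vector) gfh_data \<Rightarrow> bool" where
  "gfh_valid D \<longleftrightarrow>
     complex_space_basis D \<and> fin_dim_space (ar D) \<and>
     bilin_on (ar D) (ar D) (ar D) (fmap D) \<and> symmetric_on (ar D) (fmap D) \<and>
     (\<forall>X\<in>ar D. \<forall>Y\<in>ar D. \<forall>Z\<in>ar D.
        fmap D (fmap D X Y) Z = fmap D (fmap D Y X) Z \<and>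
        fmap D (fmap D X Y) Z = fmap D (fmap D X Z) Y) \<and>
     bilin_on (ar D) (ar D) (aJ D) (hsym D) \<and> symmetric_on (ar D) (hsym D) \<and>
     bilin_on (ar D) (ar D) (aJ D) (halt D) \<and> antisymmetric_on (ar D) (halt D) \<and>
     (\<forall>i<dimJ D. lin_on (ar D) UNIV (alp D i)) \<and>
     bilin_on (ar D) (ar D) UNIV (gzero D) \<and> symmetric_on (ar D) (gzero D) \<and>
     bilin_on (ar D) (ar D) UNIV (tauzero D) \<and> antisymmetric_on (ar D) (tauzero D) \<and>
     (\<forall>p\<in>gfh_carr D. p \<noteq> 0 \<longrightarrow> gfh_met D p p > 0)"

definition wedge12 :: "('v \<Rightarrow> complex) \<Rightarrow> ('v \<Rightarrow> 'v \<Rightarrow> complex) \<Rightarrow> 'v \<Rightarrow> 'v \<Rightarrow> 'v \<Rightarrow> complex" where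
  "wedge12 a b X Y Z = a X * b Y Z - a Y * b X Z + a Z * b X Y"

abbreviation hcomp :: "('c::real_vector, 'v) gfh_data \<Rightarrow> nat \<Rightarrow> 'v \<Rightarrow> 'v \<Rightarrow> complex" where
  "hcomp D i X W \<equiv> coordJ D i (hmap D X W)"

abbreviation h2comp :: "('c::real_vector, 'v) gfh_data \<Rightarrow> nat \<Rightarrow> 'v \<Rightarrow> 'v \<Rightarrow> complex" where
  "h2comp D i X W \<equiv> coordJ D i (halt D X W)"

definition gfh_equations :: "('c::real_vector, 'v::real_vector) gfh_data \<Rightarrow> bool" where
  "gfh_equations D \<longleftrightarrow>
     (\<forall>i<dimJ D. \<forall>X1\<in>ar D. \<forall>X2\<in>ar D. \<forall>X3\<in>ar D.
        alp D i X1 * hcomp D i X2 X3 - alp D i X2 * hcomp D i X1 X3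
          = hcomp D i X2 (fmap D X1 X3) - hcomp D i X1 (fmap D X2 X3) \<and>
        wedge12 (alp D i) (h2comp D i) X1 X2 X3 = 0)"

text \<open>The defining relations, recovered from the definition of \<open>gfh\<close>.\<close>

lemma coordJ_eqI:
  assumes "complex_space_basis D" "y \<in> aJ D" "cexpansion D y c"
  shows "coordJ D i y = c i"
proof -
  have "\<exists>!c. cexpansion D y c"
    using assms(1,2) unfolding complex_space_basis_def by blast
  then have "(THE c. cexpansion D y c) = c"
    using assms(3) by (auto intro: the1_equality)
  then show ?thesis by (simp add: coordJ_def)
qed

lemma lin_on_zero: "subspace S \<Longrightarrow> lin_on S T p \<Longrightarrow> p 0 = 0"
  unfolding lin_on_def by (metis scale_zero_left subspace_0)

lemma coordJ_cscale_baseY: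
  assumes "complex_space_basis D" "i < dimJ D"
  shows "coordJ D j (cscale D c (baseY D i)) = (if j = i then c else 0)"
proof (rule coordJ_eqI[OF assms(1)])
  have B: "subspace (aJ D)" "lin_on (aJ D) (aJ D) (mul_i D)" "baseY D i \<in> aJ D"
    using assms unfolding complex_space_basis_def by auto
  then show "cscale D c (baseY D i) \<in> aJ D"
    unfolding cscale_def lin_on_def by (auto intro: subspace_add subspace_scale)
  have "(\<Sum>j<dimJ D. cscale D (if j = i then c else 0) (baseY D j))
      = (\<Sum>j<dimJ D. if j = i then cscale D c (baseY D j) else 0)"
    by (rule sum.cong) (auto simp: cscale_def)
  then show "cexpansion D (cscale D c (baseY D i)) (\<lambda>j. if j = i then c else 0)"
    using assms(2) by (auto simp: cexpansion_def)
qed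

lemma coordJ_zero: "complex_space_basis D \<Longrightarrow> coordJ D j 0 = 0"
  by (rule coordJ_eqI[where c = "\<lambda>_. 0"])
     (auto simp: complex_space_basis_def subspace_0 cexpansion_def cscale_def)

lemma gfh_brk_relations:
  assumes D: "gfh_valid D" and X: "X \<in> ar D" and W: "W \<in> ar D"
    and i: "i < dimJ D" and j: "j < dimJ D"
  shows "gfh_brk D (cscale D c (baseY D i), 0, 0) (cscale D c' (baseY D j), 0, 0) = 0"
    and "gfh_brk D (0, X, 0) (cscale D c (baseY D i), 0, 0) = 0"
    and "gfh_brk D (0, X, 0) (0, W, 0) = 0"
    and "gfh_brk D (0, 0, X) (cscale D c (baseY D i), 0, 0)
           = (cscale D (alp D i X * c) (baseY D i), 0, 0)"
    and "gfh_brk D (0, 0, X) (0, W, 0) = (hmap D X W, fmap D X W, 0)"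
    and "gfh_brk D (0, 0, X) (0, 0, W) = (cscale D (2 * \<i>) (halt D X W), 0, 0)"
proof -
  have B: "complex_space_basis D" and S: "subspace (ar D)"
    using D unfolding gfh_valid_def fin_dim_space_def by (blast, metis subspace_span)
  have SJ: "subspace (aJ D)" and J: "lin_on (aJ D) (aJ D) (mul_i D)"
    using B unfolding complex_space_basis_def by auto
  have "mul_i D 0 = 0" by (rule lin_on_zero[OF SJ J])
  then have cs: "cscale D c 0 = 0" for c by (simp add: cscale_def)
  have c0: "cscale D 0 y = 0" for y by (simp add: cscale_def)
  have bil: "b 0 U = 0 \<and> b U 0 = 0" if "bilin_on (ar D) (ar D) T b" "U \<in> ar D"
    for U and T :: "'z::real_vector set" and b
    using that S lin_on_zero[OF S] unfolding bilin_on_def by blast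
  have D': "bilin_on (ar D) (ar D) (ar D) (fmap D)" "bilin_on (ar D) (ar D) (aJ D) (hsym D)"
    "bilin_on (ar D) (ar D) (aJ D) (halt D)" "\<forall>i<dimJ D. lin_on (ar D) UNIV (alp D i)"
    using D unfolding gfh_valid_def by blast+
  note O = subspace_0[OF S]
  have b0: "fmap D 0 U = 0" "fmap D U 0 = 0" "halt D 0 U = 0" "halt D U 0 = 0"
    "hmap D 0 U = 0" "hmap D U 0 = 0" if "U \<in> ar D" for U
    using bil[OF D'(1) that] bil[OF D'(2) that] bil[OF D'(3) that] by (auto simp: hmap_def)
  have a0: "actJ D U 0 = 0" for U
    using coordJ_zero[OF B] by (simp add: actJ_def cscale_def)
  have a1: "actJ D 0 y = 0" for y
  proof -
    have "alp D i 0 = 0" if "i < dimJ D" for i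
      using D'(4) that lin_on_zero[OF S] by blast
    then show ?thesis by (simp add: actJ_def cscale_def)
  qed
  have a2: "actJ D X (cscale D c (baseY D i)) = cscale D (alp D i X * c) (baseY D i)"
  proof -
    have "actJ D X (cscale D c (baseY D i))
        = (\<Sum>j<dimJ D. if j = i then cscale D (alp D j X * c) (baseY D j) else 0)"
      unfolding actJ_def by (rule sum.cong) (auto simp: coordJ_cscale_baseY[OF B i] c0)
    then show ?thesis using i by simp
  qed
  note s = b0[OF O] b0[OF X] b0[OF W] a0 a1 a2 cs
  show "gfh_brk D (cscale D c (baseY D i), 0, 0) (cscale D c' (baseY D j), 0, 0) = 0"
    "gfh_brk D (0, X, 0) (cscale D c (baseY D i), 0, 0) = 0"
    "gfh_brk D (0, X, 0) (0, W, 0) = 0"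
    "gfh_brk D (0, 0, X) (cscale D c (baseY D i), 0, 0)
           = (cscale D (alp D i X * c) (baseY D i), 0, 0)"
    "gfh_brk D (0, 0, X) (0, W, 0) = (hmap D X W, fmap D X W, 0)"
    "gfh_brk D (0, 0, X) (0, 0, W) = (cscale D (2 * \<i>) (halt D X W), 0, 0)"
    by (simp_all add: s zero_prod_def)
qed

lemma gfh_met_relations:
  assumes D: "gfh_valid D" and X: "X \<in> ar D" and W: "W \<in> ar D" and y: "y \<in> aJ D"
    and i: "i < dimJ D" and j: "j < dimJ D"
  shows "gfh_met D (cscale D c (baseY D i), 0, 0) (cscale D c' (baseY D j), 0, 0)
           = (if i = j then Re (c * cnj c') else 0)"
    and "gfh_met D (y, 0, 0) (0, X, W) = 0"
    and "gfh_met D (0, X, 0) (0, W, 0) = gzero D X W"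
    and "gfh_met D (gfh_acs D (0, X, 0)) (gfh_acs D (0, W, 0)) = gzero D X W"
    and "gfh_met D (gfh_acs D (0, X, 0)) (0, W, 0) = tauzero D X W"
    and "gfh_met D (0, X, 0) (gfh_acs D (0, W, 0)) = - tauzero D X W"
proof -
  have B: "complex_space_basis D" and S: "subspace (ar D)"
    using D unfolding gfh_valid_def fin_dim_space_def by (blast, metis subspace_span)
  have SJ: "subspace (aJ D)" and J: "lin_on (aJ D) (aJ D) (mul_i D)"
    using B unfolding complex_space_basis_def by auto
  have m0: "mul_i D 0 = 0" by (rule lin_on_zero[OF SJ J])
  have bil: "b 0 U = 0 \<and> b U 0 = 0"
    if "bilin_on (ar D) (ar D) (UNIV :: real set) b" "U \<in> ar D" for U b
    using that S lin_on_zero[OF S] unfolding bilin_on_def by blast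
  have D': "bilin_on (ar D) (ar D) UNIV (gzero D)" "bilin_on (ar D) (ar D) UNIV (tauzero D)"
    using D unfolding gfh_valid_def by blast+
  have b0: "gzero D 0 U = 0" "gzero D U 0 = 0" "tauzero D 0 U = 0" "tauzero D U 0 = 0"
    if "U \<in> ar D" for U
    using bil[OF D'(1) that] bil[OF D'(2) that] by auto
  note s = b0[OF subspace_0[OF S]] b0[OF X] b0[OF W] m0 coordJ_zero[OF B]
  have "(\<Sum>l<dimJ D. Re (coordJ D l (cscale D c (baseY D i)) *
                      cnj (coordJ D l (cscale D c' (baseY D j)))))
      = (\<Sum>l<dimJ D. if l = i then (if i = j then Re (c * cnj c') else 0) else 0)"
    by (rule sum.cong) (auto simp: coordJ_cscale_baseY[OF B i] coordJ_cscale_baseY[OF B j])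
  then show "gfh_met D (cscale D c (baseY D i), 0, 0) (cscale D c' (baseY D j), 0, 0)
           = (if i = j then Re (c * cnj c') else 0)"
    using i by (simp add: s)
  show "gfh_met D (y, 0, 0) (0, X, W) = 0"
    "gfh_met D (0, X, 0) (0, W, 0) = gzero D X W"
    "gfh_met D (gfh_acs D (0, X, 0)) (gfh_acs D (0, W, 0)) = gzero D X W"
    "gfh_met D (gfh_acs D (0, X, 0)) (0, W, 0) = tauzero D X W"
    "gfh_met D (0, X, 0) (gfh_acs D (0, W, 0)) = - tauzero D X W"
    by (simp_all add: s)
qed

end

theory Submission
  imports Defs "HOL-Computational_Algebra.Fundamental_Theorem_Algebra"
begin

text \<open>
  The algebraic half is a direct computation. For the converse put
  \<open>\<aa>\<^sub>J = \<gg>' \<inter> J \<gg>'\<close> and let \<open>\<aa>\<^sub>r\<close> be its orthogonal complement in \<open>\<gg>'\<close>. Integrability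
  makes every \<open>A\<^sub>X = [J X, \<cdot>]\<close>, \<open>X \<in> \<gg>'\<close>, complex linear on \<open>\<aa>\<^sub>J\<close> and shows that
  \<open>[J X, W] - [J W, X] \<in> \<aa>\<^sub>J\<close>; the splitting \<open>[J X, W] = f(X, W) + h(X, W)\<close> then gives \<open>f\<close>
  and \<open>h\<close>, and the equations are the Jacobi identity. What remains is a unitary basis of \<open>\<aa>\<^sub>J\<close>
  diagonalizing the commuting family \<open>A\<^sub>X\<close>. The SKT condition on \<open>(X, J X, y, z)\<close> with
  \<open>y, z \<in> \<aa>\<^sub>J\<close> reads \<open>F + F\<^sup>* + A\<^sup>2 + A\<^sup>*\<^sup>2 + 2 A\<^sup>* A = 0\<close> for \<open>A = A\<^sub>X\<close> and
  \<open>F = A\<^sub>[\<^sub>J\<^sub>X\<^sub>,\<^sub>X\<^sub>]\<close>, and this identity rules out off-diagonal terms in a simultaneous unitary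
  triangularization.
\<close>

section \<open>Finite-dimensional subspaces\<close>

text \<open>Commutativity alone gives the maps \<open>A\<^sub>X\<close> only a common unitary
  triangular form, and no single \<open>A\<^sub>X\<close> is known to be normal in advance. The
  identity becomes decisive because \<open>F\<close> belongs to the same family: it commutes with
  \<open>A\<close> and has the same common eigenvectors. Let \<alpha> be the eigenvalue of
  \<open>A\<close> on an eigenvector \<open>e\<close>, let a be the diagonal entry at the next
  vector \<open>u\<close>, b the entry linking \<open>u\<close> to \<open>e\<close>, c = a -
  \<alpha>, and let a prime mark the entries of \<open>F\<close>. The diagonal entries of the
  identity give Re \<alpha>' = -2 (Re \<alpha>)^2 and Re a' \<le> -2 (Re a)^2 - |b|^2. Its
  off-diagonal entry gives b' = -(4 Re \<alpha> + c) b, and commutativity gives c' b = c b'. If b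
  were nonzero, then c' = -(4 Re \<alpha> + c) c, and comparing real parts would leave |c|^2 + |b|^2
  \<le> 0.\<close>

lemma lin_on_sum:
  assumes "lin_on S T p" "subspace S" "\<And>i. i \<in> I \<Longrightarrow> x i \<in> S"
  shows "p (\<Sum>i\<in>I. x i) = (\<Sum>i\<in>I. p (x i))"
  using assms(3)
proof (induction I rule: infinite_finite_induct)
  case (insert i I)
  then have "x i \<in> S" "(\<Sum>i\<in>I. x i) \<in> S"
    using assms(2) by (auto intro: subspace_sum)
  with insert assms(1) show ?case by (simp add: lin_on_def)
qed (use assms(1,2) lin_on_zero in auto)

lemma lin_on_minus: "subspace S \<Longrightarrow> lin_on S T p \<Longrightarrow> x \<in> S \<Longrightarrow> p (- x) = - p x"
  unfolding lin_on_def by (metis scaleR_minus1_left)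

lemma lin_on_diff:
  "subspace S \<Longrightarrow> lin_on S T p \<Longrightarrow> x \<in> S \<Longrightarrow> y \<in> S \<Longrightarrow> p (x - y) = p x - p y"
  using lin_on_minus[of S T p y] subspace_neg[of S y] unfolding lin_on_def
  by (metis diff_conv_add_uminus)

text \<open>A vector outside \<open>U\<close> can be added to an independent spanning set of
  \<open>U\<close> without leaving \<open>span B\<close>, which uses up one element of the bound
  \<open>card B\<close>. The size of a finite spanning set thus serves as induction measure in
  \<open>common_eigenvector\<close>.\<close>

lemma fin_dim_psubspace:
  assumes "subspace U" "U \<subset> span B" "finite B"
  obtains C where "finite C" "card C < card B" "span C = U"
proof -
  obtain C where C: "C \<subseteq> U" "independent C" "U \<subseteq> span C"
    by (meson maximal_independent_subset)
  have sC: "span C = U" using C assms(1) by (simp add: span_minimal subset_antisym)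
  obtain v where v: "v \<in> span B" "v \<notin> U" using assms(2) by auto
  have "independent (insert v C)" using C(2) v sC by (simp add: independent_insert)
  moreover have "insert v C \<subseteq> span B" using v C(1) assms(2) by auto
  ultimately have "finite (insert v C) \<and> card (insert v C) \<le> card B"
    by (rule independent_span_bound[OF assms(3)])
  then have f: "finite C" "card (insert v C) \<le> card B" by auto
  have "v \<notin> C" using v C(1) by auto
  then show ?thesis using f sC by (intro that[of C]) auto
qed

lemma fin_dim_space_subspace:
  assumes "subspace U" "U \<subseteq> V" "fin_dim_space V"
  shows "fin_dim_space U"
  using assms fin_dim_psubspace unfolding fin_dim_space_def by (metis psubsetI)

lemma fin_dim_space_Times:
  assumes "fin_dim_space S" "fin_dim_space T"
  shows "fin_dim_space (S \<times> T)"
proof -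
  obtain B C where B: "finite B" "span B = S" and C: "finite C" "span C = T"
    using assms unfolding fin_dim_space_def by blast
  let ?D = "(\<lambda>x. (x, 0)) ` B \<union> (\<lambda>x. (0, x)) ` C"
  have l: "linear (\<lambda>x. (x, 0))" "linear (\<lambda>x. (0, x))"
    by (auto simp: linear_iff)
  have 1: "span ((\<lambda>x. (x, 0)) ` B) = (\<lambda>x. (x, 0)) ` S"
    "span ((\<lambda>x. (0, x)) ` C) = (\<lambda>x. (0, x)) ` T"
    using linear_span_image[OF l(1), of B] linear_span_image[OF l(2), of C] B C by simp_all
  have "span ?D = S \<times> T"
  proof (rule set_eqI)
    fix p
    have "p \<in> span ?D \<longleftrightarrow> (\<exists>a\<in>S. \<exists>b\<in>T. p = (a, 0) + (0, b))"
      unfolding span_Un 1 by blast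
    then show "p \<in> span ?D \<longleftrightarrow> p \<in> S \<times> T" by (cases p) auto
  qed
  moreover have "finite ?D" using B C by simp
  ultimately show ?thesis unfolding fin_dim_space_def by metis
qed

text \<open>Phrased for indexed families because iterates of a map may repeat. Two equal members
  give a relation at once; otherwise there are \<open>card B + 1\<close> distinct vectors in
  \<open>span B\<close>.\<close>

lemma linear_relation_span:
  fixes w :: "nat \<Rightarrow> 'a::real_vector"
  assumes "finite B" "\<And>i. i \<le> card B \<Longrightarrow> w i \<in> span B"
  obtains c k where "k \<le> card B" "c k \<noteq> 0" "(\<Sum>i\<le>card B. c i *\<^sub>R w i) = 0"
proof (cases "inj_on w {..card B}")
  case True
  have "card (w ` {..card B}) = Suc (card B)" using True by (simp add: card_image)
  moreover have "w ` {..card B} \<subseteq> span B" using assms(2) by auto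
  ultimately have "dependent (w ` {..card B})"
    using independent_span_bound[OF assms(1)] by force
  then obtain u where u: "\<exists>v\<in>w ` {..card B}. u v \<noteq> 0" "(\<Sum>v\<in>w ` {..card B}. u v *\<^sub>R v) = 0"
    by (auto simp: dependent_finite)
  then have "(\<Sum>i\<le>card B. u (w i) *\<^sub>R w i) = 0"
    by (simp add: sum.reindex[OF True])
  then show ?thesis using u(1) that[of _ "\<lambda>i. u (w i)"] by auto
next
  case False
  then obtain i j where ij: "i \<le> card B" "j \<le> card B" "i \<noteq> j" "w i = w j"
    unfolding inj_on_def by auto
  let ?c = "\<lambda>k. (if k = i then 1 else 0) - (if k = j then 1 else 0 :: real)"
  have "(\<Sum>k\<le>card B. ?c k *\<^sub>R w k)
      = (\<Sum>k\<le>card B. if k = i then w k else 0) - (\<Sum>k\<le>card B. if k = j then w k else 0)"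
    unfolding sum_subtractf[symmetric] by (rule sum.cong) auto
  also have "\<dots> = 0" using ij by simp
  finally show ?thesis using ij by (intro that[of i ?c]) auto
qed

section \<open>Complex structures on subspaces\<close>

definition cmul :: "('a::real_vector \<Rightarrow> 'a) \<Rightarrow> complex \<Rightarrow> 'a \<Rightarrow> 'a" where
  "cmul J c x = Re c *\<^sub>R x + Im c *\<^sub>R J x"

definition clin_on :: "'a::real_vector set \<Rightarrow> ('a \<Rightarrow> 'a) \<Rightarrow> ('a \<Rightarrow> 'a) \<Rightarrow> bool" where
  "clin_on V J T \<longleftrightarrow> lin_on V V T \<and> (\<forall>x\<in>V. T (J x) = J (T x))"

locale complex_space =
  fixes V :: "'a::real_vector set" and J :: "'a \<Rightarrow> 'a"
  assumes V_subspace: "subspace V"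
    and J_lin: "lin_on V V J"
    and J_J: "x \<in> V \<Longrightarrow> J (J x) = - x"
begin

lemma V_add [simp, intro]: "x \<in> V \<Longrightarrow> y \<in> V \<Longrightarrow> x + y \<in> V"
  and V_diff [simp, intro]: "x \<in> V \<Longrightarrow> y \<in> V \<Longrightarrow> x - y \<in> V"
  and V_scale [simp, intro]: "x \<in> V \<Longrightarrow> r *\<^sub>R x \<in> V"
  and V_minus [simp, intro]: "x \<in> V \<Longrightarrow> - x \<in> V"
  and V_zero [simp]: "0 \<in> V"
  and V_sum [intro]: "(\<And>i. i \<in> I \<Longrightarrow> f i \<in> V) \<Longrightarrow> (\<Sum>i\<in>I. f i) \<in> V"
  using V_subspace
  by (auto simp: subspace_add subspace_diff subspace_scale subspace_neg subspace_0 subspace_sum)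

lemma J_in [simp, intro]: "x \<in> V \<Longrightarrow> J x \<in> V"
  and J_add: "x \<in> V \<Longrightarrow> y \<in> V \<Longrightarrow> J (x + y) = J x + J y"
  and J_scale: "x \<in> V \<Longrightarrow> J (r *\<^sub>R x) = r *\<^sub>R J x"
  using J_lin by (auto simp: lin_on_def)

lemma J_zero: "J 0 = 0"
  and J_minus: "x \<in> V \<Longrightarrow> J (- x) = - J x"
  and J_diff: "x \<in> V \<Longrightarrow> y \<in> V \<Longrightarrow> J (x - y) = J x - J y"
  using V_subspace J_lin lin_on_zero lin_on_minus lin_on_diff by blast+

lemmas J_simps = J_add J_scale J_zero J_minus J_diff J_J

lemma cmul_in [simp, intro]: "x \<in> V \<Longrightarrow> cmul J c x \<in> V"
  by (simp add: cmul_def)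

lemma cmul_add: "x \<in> V \<Longrightarrow> y \<in> V \<Longrightarrow> cmul J c (x + y) = cmul J c x + cmul J c y"
  by (simp add: cmul_def J_simps algebra_simps)

lemma cmul_lin: "lin_on V V (cmul J c)"
  by (auto simp: lin_on_def cmul_add) (simp add: cmul_def J_simps algebra_simps)

lemma cmul_add_left: "cmul J (c + d) x = cmul J c x + cmul J d x"
  by (simp add: cmul_def algebra_simps)

lemma cmul_diff_left: "cmul J (c - d) x = cmul J c x - cmul J d x"
  by (simp add: cmul_def algebra_simps)

lemma cmul_cmul: "x \<in> V \<Longrightarrow> cmul J c (cmul J d x) = cmul J (c * d) x"
  by (simp add: cmul_def J_simps algebra_simps)

lemma cmul_J: "x \<in> V \<Longrightarrow> cmul J c (J x) = J (cmul J c x)"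
  by (simp add: cmul_def J_simps)

lemma cmul_0_left [simp]: "cmul J 0 x = 0"
  and cmul_1 [simp]: "cmul J 1 x = x"
  and cmul_0_right [simp]: "cmul J c 0 = 0"
  and cmul_i: "cmul J \<i> x = J x"
  and cmul_of_real: "cmul J (of_real r) x = r *\<^sub>R x"
  by (simp_all add: cmul_def J_zero)

lemma cmul_sum: "(\<And>i. i \<in> I \<Longrightarrow> x i \<in> V) \<Longrightarrow> cmul J c (\<Sum>i\<in>I. x i) = (\<Sum>i\<in>I. cmul J c (x i))"
  using lin_on_sum[OF cmul_lin V_subspace] by blast

lemma cmul_eq_0: "x \<in> V \<Longrightarrow> cmul J c x = 0 \<Longrightarrow> c = 0 \<or> x = 0"
  using cmul_cmul[of x "1 / c" c] by (cases "c = 0") auto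

lemma clin_onD:
  assumes "clin_on V J T"
  shows "lin_on V V T" and "x \<in> V \<Longrightarrow> T x \<in> V"
    and "x \<in> V \<Longrightarrow> y \<in> V \<Longrightarrow> T (x + y) = T x + T y"
    and "x \<in> V \<Longrightarrow> T (J x) = J (T x)"
    and "x \<in> V \<Longrightarrow> T (cmul J c x) = cmul J c (T x)"
  using assms by (auto simp: clin_on_def lin_on_def cmul_def)

text \<open>The iterates of \<open>T\<close> on a nonzero vector satisfy a nontrivial polynomial
  relation, from which linear factors are split off by the fundamental theorem of algebra.\<close>

lemma clin_on_eigenvector:
  assumes "fin_dim_space V" "V \<noteq> {0}" "clin_on V J T"
  obtains v c where "v \<in> V" "v \<noteq> 0" "T v = cmul J c v"
proof -
  note T = clin_onD[OF assms(3)]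
  obtain v where v: "v \<in> V" "v \<noteq> 0" using assms(2) V_zero by blast
  define w where "w i = (T ^^ i) v" for i
  have w: "w i \<in> V" for i by (induction i) (auto simp: w_def v T)
  \<comment> \<open>\<open>act p\<close> is the vector \<open>p(T) v\<close>.\<close>
  define act where "act p = (\<Sum>i\<le>degree p. cmul J (coeff p i) (w i))" for p
  have act_eq: "act p = (\<Sum>i\<le>n. cmul J (coeff p i) (w i))" if "degree p \<le> n" for p n
    unfolding act_def using that
    by (intro sum.mono_neutral_left) (auto simp: coeff_eq_0)
  have act_in: "act p \<in> V" for p unfolding act_def using w by auto
  have act_pCons: "act (pCons 0 q) = T (act q)" for q
  proof -
    have "act (pCons 0 q) = (\<Sum>i\<le>Suc (degree q). cmul J (coeff (pCons 0 q) i) (w i))"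
      by (intro act_eq) (simp add: degree_pCons_le)
    also have "\<dots> = (\<Sum>i\<le>degree q. cmul J (coeff q i) (w (Suc i)))"
      by (subst sum.atMost_Suc_shift) simp
    also have "\<dots> = T (act q)"
      unfolding act_def using w by (subst lin_on_sum[OF T(1) V_subspace])
        (auto simp: T w_def intro!: sum.cong)
    finally show ?thesis .
  qed
  have act_factor: "act ([:- c, 1:] * q) = T (act q) - cmul J c (act q)" for c q
  proof -
    let ?n = "Suc (degree q)"
    have "[:- c, 1:] * q = pCons 0 q - smult c q" by simp
    then have "act ([:- c, 1:] * q) = (\<Sum>i\<le>?n. cmul J (coeff (pCons 0 q - smult c q) i) (w i))"
      using act_eq[of "[:- c, 1:] * q" ?n] degree_mult_le[of "[:- c, 1:]" q] by simp
    also have "\<dots> = (\<Sum>i\<le>?n. cmul J (coeff (pCons 0 q) i) (w i) - cmul J c (cmul J (coeff q i) (w i)))"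
      by (rule sum.cong) (auto simp: cmul_cmul w cmul_diff_left)
    also have "\<dots> = act (pCons 0 q) - cmul J c (act q)"
      using act_eq[of "pCons 0 q" ?n] act_eq[of q ?n] w
      by (simp add: sum_subtractf cmul_sum degree_pCons_le del: sum.atMost_Suc)
    finally show ?thesis by (simp add: act_pCons)
  qed
  \<comment> \<open>For a root \<open>c\<close> and \<open>p = (X - c) q\<close>, either
    \<open>q(T) v\<close> is an eigenvector for \<open>c\<close>, or it vanishes and the degree has
    dropped. A nonzero constant cannot annihilate \<open>v\<close>, so the descent stops in
    time.\<close>
  have *: "\<exists>u c. u \<in> V \<and> u \<noteq> 0 \<and> T u = cmul J c u" if "p \<noteq> 0" "act p = 0" for p
    using that
  proof (induction "degree p" arbitrary: p)
    case 0
    then obtain a where "p = [:a:]" by (metis degree_eq_zeroE)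
    then show ?case using 0 v cmul_eq_0 by (force simp: act_def w_def)
  next
    case (Suc n)
    then obtain c where "poly p c = 0"
      using fundamental_theorem_of_algebra[of p] by (metis constant_degree nat.distinct(1))
    then obtain q where q: "p = [:- c, 1:] * q" by (auto simp: poly_eq_0_iff_dvd)
    have "q \<noteq> 0" using q Suc by auto
    then have "degree p = Suc (degree q)" unfolding q by (subst degree_mult_eq) auto
    with Suc have n: "n = degree q" by simp
    show ?case
    proof (cases "act q = 0")
      case True
      then show ?thesis using Suc.hyps(1)[OF n] \<open>q \<noteq> 0\<close> by simp
    next
      case False
      have "T (act q) = cmul J c (act q)" using act_factor[of c q] Suc q by simp
      then show ?thesis using False act_in by blast
    qed
  qed
  obtain B where B: "finite B" "span B = V" using assms(1) by (auto simp: fin_dim_space_def)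
  then obtain c k where c: "k \<le> card B" "c k \<noteq> 0" "(\<Sum>i\<le>card B. c i *\<^sub>R w i) = 0"
    using linear_relation_span[of B w] w by metis
  \<comment> \<open>The relation among the iterates has real coefficients; reading them as complex
    ones makes roots available.\<close>
  define p where "p = (\<Sum>i\<le>card B. monom (complex_of_real (c i)) i)"
  have cp: "coeff p i = (if i \<le> card B then of_real (c i) else 0)" for i
    by (simp add: p_def coeff_sum)
  have "degree p \<le> card B" by (rule degree_le) (simp add: cp)
  then have "act p = (\<Sum>i\<le>card B. c i *\<^sub>R w i)"
    by (simp add: act_eq cp cmul_of_real)
  moreover have "p \<noteq> 0" using c cp[of k] by auto
  ultimately show ?thesis using * c that by metis
qed

end

lemma complex_space_subset:
  assumes "complex_space V J" "subspace U" "U \<subseteq> V" "\<And>x. x \<in> U \<Longrightarrow> J x \<in> U"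
  shows "complex_space U J"
  using assms unfolding complex_space_def lin_on_def by blast

text \<open>If every map is scalar on \<open>V\<close>, any nonzero vector works. Otherwise an
  eigenspace of a non-scalar \<open>A s\<close> is nonzero, proper, and invariant under the whole
  family by commutativity, so induction applies to it.\<close>

lemma common_eigenvector:
  assumes "complex_space V J" "fin_dim_space V" "V \<noteq> {0}"
    and "\<And>s. s \<in> S \<Longrightarrow> clin_on V J (A s)"
    and "\<And>s t x. s \<in> S \<Longrightarrow> t \<in> S \<Longrightarrow> x \<in> V \<Longrightarrow> A s (A t x) = A t (A s x)"
  shows "\<exists>v\<in>V. v \<noteq> 0 \<and> (\<forall>s\<in>S. \<exists>c. A s v = cmul J c v)"
proof -
  obtain B where B: "finite B" "span B = V"
    using assms(2) by (auto simp: fin_dim_space_def)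
  show ?thesis
    using B assms(1,3-5)
  proof (induction "card B" arbitrary: B V rule: less_induct)
    case less
    interpret complex_space V J by fact
    have fd: "fin_dim_space V" using less.prems by (auto simp: fin_dim_space_def)
    show ?case
    proof (cases "\<forall>s\<in>S. \<exists>c. \<forall>x\<in>V. A s x = cmul J c x")
      case True
      then show ?thesis using \<open>V \<noteq> {0}\<close> V_zero by blast
    next
      case False
      then obtain s where s: "s \<in> S" "\<And>c. \<exists>x\<in>V. A s x \<noteq> cmul J c x" by blast
      note T = clin_onD[OF less.prems(5)]
      obtain v c where v: "v \<in> V" "v \<noteq> 0" "A s v = cmul J c v"
        using clin_on_eigenvector[OF fd less.prems(4) less.prems(5)[OF s(1)]] by blast
      define U where "U = {x \<in> V. A s x = cmul J c x}"
      have sU: "subspace U"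
        using T(1)[OF s(1)] cmul_lin[of c] lin_on_zero[OF V_subspace T(1)[OF s(1)]]
        by (auto simp: U_def subspace_def lin_on_def)
      have JU: "J x \<in> U" if "x \<in> U" for x
        using that T(4)[OF s(1)] by (auto simp: U_def cmul_J)
      have AU: "A t x \<in> U" if "t \<in> S" "x \<in> U" for t x
        using that T(2,5)[OF that(1)] less.prems(6)[OF s(1) that(1)] by (auto simp: U_def)
      have UV: "U \<subset> V" using s(2)[of c] by (auto simp: U_def)
      then obtain C where C: "finite C" "card C < card B" "span C = U"
        using fin_dim_psubspace[OF sU] less.prems(1,2) by blast
      have cU: "complex_space U J"
        by (rule complex_space_subset[OF less.prems(3) sU]) (use UV JU in auto)
      have nz: "U \<noteq> {0}" using v by (auto simp: U_def)
      have lU: "clin_on U J (A t)" if "t \<in> S" for t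
        using less.prems(5)[OF that] AU[OF that] UV unfolding clin_on_def lin_on_def by blast
      have "\<exists>v\<in>U. v \<noteq> 0 \<and> (\<forall>s\<in>S. \<exists>c. A s v = cmul J c v)"
        by (rule less.hyps[OF C(2,1,3) cU nz lU]) (use UV less.prems(6) in auto)
      then show ?thesis using UV by blast
    qed
  qed
qed

section \<open>Simultaneous unitary diagonalization\<close>

text \<open>The sign of the imaginary part is chosen so that, for \<open>J\<close> orthogonal with
  respect to \<open>g\<close>, the form is complex linear in the first argument and antilinear in
  the second.\<close>

definition herm :: "('a \<Rightarrow> 'a \<Rightarrow> real) \<Rightarrow> ('a \<Rightarrow> 'a) \<Rightarrow> 'a \<Rightarrow> 'a \<Rightarrow> complex" where
  "herm g J x y = Complex (g x y) (g x (J y))"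

locale hermitian_space = complex_space V J
  for V :: "'a::real_vector set" and J +
  fixes g :: "'a \<Rightarrow> 'a \<Rightarrow> real"
  assumes fin_dim: "fin_dim_space V"
    and inner: "inner_product_on V g"
    and g_J: "x \<in> V \<Longrightarrow> y \<in> V \<Longrightarrow> g (J x) (J y) = g x y"
begin

lemma g_sym: "x \<in> V \<Longrightarrow> y \<in> V \<Longrightarrow> g x y = g y x"
  and g_add: "x \<in> V \<Longrightarrow> y \<in> V \<Longrightarrow> z \<in> V \<Longrightarrow> g (x + y) z = g x z + g y z"
  and g_scale: "x \<in> V \<Longrightarrow> z \<in> V \<Longrightarrow> g (r *\<^sub>R x) z = r * g x z"
  and g_add_right: "x \<in> V \<Longrightarrow> y \<in> V \<Longrightarrow> z \<in> V \<Longrightarrow> g z (x + y) = g z x + g z y"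
  and g_scale_right: "x \<in> V \<Longrightarrow> z \<in> V \<Longrightarrow> g z (r *\<^sub>R x) = r * g z x"
  and g_pos: "x \<in> V \<Longrightarrow> x \<noteq> 0 \<Longrightarrow> g x x > 0"
  using inner by (auto simp: inner_product_on_def symmetric_on_def bilin_on_def lin_on_def)

lemma g_lin: "y \<in> V \<Longrightarrow> lin_on V UNIV (\<lambda>x. g x y)" "y \<in> V \<Longrightarrow> lin_on V UNIV (g y)"
  using inner by (auto simp: inner_product_on_def bilin_on_def)

lemma g_minus: "x \<in> V \<Longrightarrow> y \<in> V \<Longrightarrow> g (- x) y = - g x y"
  and g_minus_right: "x \<in> V \<Longrightarrow> y \<in> V \<Longrightarrow> g x (- y) = - g x y"
  and g_zero: "y \<in> V \<Longrightarrow> g 0 y = 0"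
  and g_zero_right: "y \<in> V \<Longrightarrow> g y 0 = 0"
  using lin_on_minus[OF V_subspace g_lin(1)] lin_on_minus[OF V_subspace g_lin(2)]
    lin_on_zero[OF V_subspace g_lin(1)] lin_on_zero[OF V_subspace g_lin(2)] by auto

lemma g_diff: "x \<in> V \<Longrightarrow> y \<in> V \<Longrightarrow> z \<in> V \<Longrightarrow> g (x - y) z = g x z - g y z"
  using lin_on_diff[OF V_subspace g_lin(1)] by auto

lemma g_J_left: "x \<in> V \<Longrightarrow> y \<in> V \<Longrightarrow> g (J x) y = - g x (J y)"
  using g_J[of x "J y"] by (simp add: J_J g_minus_right)

abbreviation H :: "'a \<Rightarrow> 'a \<Rightarrow> complex" where
  "H \<equiv> herm g J"

lemma H_add: "x \<in> V \<Longrightarrow> y \<in> V \<Longrightarrow> z \<in> V \<Longrightarrow> H (x + y) z = H x z + H y z"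
  and H_diff: "x \<in> V \<Longrightarrow> y \<in> V \<Longrightarrow> z \<in> V \<Longrightarrow> H (x - y) z = H x z - H y z"
  and H_minus: "x \<in> V \<Longrightarrow> z \<in> V \<Longrightarrow> H (- x) z = - H x z"
  and H_scale: "x \<in> V \<Longrightarrow> z \<in> V \<Longrightarrow> H (r *\<^sub>R x) z = of_real r * H x z"
  and H_zero: "z \<in> V \<Longrightarrow> H 0 z = 0"
  and H_J: "x \<in> V \<Longrightarrow> z \<in> V \<Longrightarrow> H (J x) z = \<i> * H x z"
  and H_cnj: "x \<in> V \<Longrightarrow> z \<in> V \<Longrightarrow> H z x = cnj (H x z)"
  by (auto simp: herm_def complex_eq_iff g_add g_diff g_minus g_scale g_J_left J_J g_minus_right
      J_zero g_zero g_zero_right)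
     (use g_sym g_J_left J_in in metis)+

lemma H_cmul: "x \<in> V \<Longrightarrow> z \<in> V \<Longrightarrow> H (cmul J c x) z = c * H x z"
  by (simp add: cmul_def H_add H_scale H_J complex_eq_iff algebra_simps)

lemma H_cmul_right: "x \<in> V \<Longrightarrow> z \<in> V \<Longrightarrow> H z (cmul J c x) = cnj c * H z x"
  by (metis H_cmul H_cnj cmul_in complex_cnj_mult)

lemma H_add_right: "x \<in> V \<Longrightarrow> y \<in> V \<Longrightarrow> z \<in> V \<Longrightarrow> H z (x + y) = H z x + H z y"
  by (metis H_add H_cnj V_add complex_cnj_add)

lemma H_sum:
  assumes "\<And>i. i \<in> I \<Longrightarrow> x i \<in> V" "z \<in> V"
  shows "H (\<Sum>i\<in>I. x i) z = (\<Sum>i\<in>I. H (x i) z)"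
proof -
  have "lin_on V UNIV (\<lambda>x. H x z)"
    using assms(2) by (auto simp: lin_on_def H_add H_scale scaleR_conv_of_real)
  then show ?thesis using lin_on_sum[OF _ V_subspace] assms(1) by blast
qed

lemma Re_H_self: "Re (H x x) = g x x"
  by (simp add: herm_def)

lemma H_self: "x \<in> V \<Longrightarrow> H x x = of_real (g x x)"
  using H_cnj[of x x] by (auto simp: complex_eq_iff Re_H_self)

definition orthonormal :: "nat \<Rightarrow> (nat \<Rightarrow> 'a) \<Rightarrow> bool" where
  "orthonormal n e \<longleftrightarrow>
     (\<forall>i<n. e i \<in> V) \<and> (\<forall>i<n. \<forall>j<n. H (e i) (e j) = (if i = j then 1 else 0))"

definition proj :: "nat \<Rightarrow> (nat \<Rightarrow> 'a) \<Rightarrow> 'a \<Rightarrow> 'a" where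
  "proj n e x = (\<Sum>i<n. cmul J (H x (e i)) (e i))"

text \<open>Real independence of the \<open>e i\<close> already bounds \<open>n\<close>, so that a
  family of maximal length exists in \<open>simultaneous_diagonalization\<close>.\<close>

lemma orthonormal_bound:
  assumes "finite B" "span B = V" "orthonormal n e"
  shows "n \<le> card B"
proof (rule ccontr)
  assume "\<not> n \<le> card B"
  then have e: "\<And>i. i \<le> card B \<Longrightarrow> i < n" by auto
  then have eV: "\<And>i. i \<le> card B \<Longrightarrow> e i \<in> V" using assms(3) by (auto simp: orthonormal_def)
  then obtain c k where c: "k \<le> card B" "c k \<noteq> 0" "(\<Sum>i\<le>card B. c i *\<^sub>R e i) = 0"
    using linear_relation_span[OF assms(1), of e] assms(2) by metis
  have "0 = H (\<Sum>i\<le>card B. c i *\<^sub>R e i) (e k)" using c eV by (simp add: H_zero)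
  also have "\<dots> = (\<Sum>i\<le>card B. of_real (c i) * H (e i) (e k))"
    using eV c(1) by (subst H_sum) (auto simp: H_scale)
  also have "\<dots> = (\<Sum>i\<le>card B. if i = k then of_real (c i) else 0)"
    using assms(3) e c(1) by (intro sum.cong) (auto simp: orthonormal_def)
  finally show False using c by simp
qed

lemma proj_in: "orthonormal n e \<Longrightarrow> x \<in> V \<Longrightarrow> proj n e x \<in> V"
  by (auto simp: proj_def orthonormal_def)

lemma proj_clin: "orthonormal n e \<Longrightarrow> clin_on V J (proj n e)"
proof -
  assume o: "orthonormal n e"
  then have e: "\<And>i. i < n \<Longrightarrow> e i \<in> V" by (auto simp: orthonormal_def)
  have "proj n e (x + y) = proj n e x + proj n e y" if "x \<in> V" "y \<in> V" for x y
    using that e by (auto simp: proj_def H_add cmul_add_left sum.distrib[symmetric] intro!: sum.cong)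
  moreover have "proj n e (cmul J c x) = cmul J c (proj n e x)" if "x \<in> V" for x c
    unfolding proj_def using that e by (subst cmul_sum) (auto simp: H_cmul cmul_cmul)
  from this[of _ "of_real _"] this[of _ \<i>]
  have "proj n e (r *\<^sub>R x) = r *\<^sub>R proj n e x" "proj n e (J x) = J (proj n e x)" if "x \<in> V" for x r
    using that by (auto simp: cmul_of_real cmul_i)
  ultimately show ?thesis using proj_in[OF o] by (auto simp: clin_on_def lin_on_def)
qed

lemma H_proj:
  assumes "orthonormal n e" "x \<in> V" "j < n"
  shows "H (proj n e x) (e j) = H x (e j)"
proof -
  have e: "\<And>i. i < n \<Longrightarrow> e i \<in> V" using assms by (auto simp: orthonormal_def)
  have "H (proj n e x) (e j) = (\<Sum>i<n. H x (e i) * H (e i) (e j))"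
    unfolding proj_def using e assms(3) by (subst H_sum) (auto simp: H_cmul)
  also have "\<dots> = (\<Sum>i<n. if i = j then H x (e i) else 0)"
    using assms by (intro sum.cong) (auto simp: orthonormal_def)
  finally show ?thesis using assms(3) by simp
qed

lemma proj_base:
  assumes "orthonormal n e" "j < n"
  shows "proj n e (e j) = e j"
proof -
  have "proj n e (e j) = (\<Sum>i<n. if i = j then e i else 0)"
    unfolding proj_def using assms by (intro sum.cong) (auto simp: orthonormal_def)
  then show ?thesis using assms(2) by simp
qed

text \<open>
  The key step. A common eigenvector \<open>u\<close> of the compressions of the \<open>A s\<close> to the complement of
  the common eigenvectors found so far satisfies \<open>A s u = a s u + \<Sum>\<^sub>j b\<^sub>j s e\<^sub>j\<close>. Commutativity makes
  \<open>b\<^sub>j\<close> proportional to \<open>a - a\<^sub>j\<close>, and the real parts of the identity \<open>eq\<close> on \<open>u\<close>, \<open>e\<^sub>j\<close> then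
  express \<open>\<bar>b\<^sub>j\<bar>\<^sup>2\<close> as minus a sum of squares.
\<close>

lemma compressed_eigenvector:
  assumes A: "\<And>s. s \<in> S \<Longrightarrow> clin_on V J (A s)"
    and comm: "\<And>s t x. s \<in> S \<Longrightarrow> t \<in> S \<Longrightarrow> x \<in> V \<Longrightarrow> A s (A t x) = A t (A s x)"
    and f: "\<And>s. s \<in> S \<Longrightarrow> f s \<in> S"
    and eq: "\<And>s y z. s \<in> S \<Longrightarrow> y \<in> V \<Longrightarrow> z \<in> V \<Longrightarrow>
        H (A (f s) y) z + H y (A (f s) z) + H (A s (A s y)) z + H y (A s (A s z))
          + 2 * H (A s y) (A s z) = 0"
    and e: "orthonormal n e" "\<And>s i. s \<in> S \<Longrightarrow> i < n \<Longrightarrow> A s (e i) = cmul J (a' i s) (e i)"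
    and u: "u \<in> V" "H u u = 1" "\<And>i. i < n \<Longrightarrow> H u (e i) = 0"
    and Au: "\<And>s. s \<in> S \<Longrightarrow> A s u = cmul J (a s) u + proj n e (A s u)"
    and s: "s \<in> S" and j: "j < n"
  shows "H (A s u) (e j) = 0"
proof (rule ccontr)
  assume nz: "H (A s u) (e j) \<noteq> 0"
  define b where "b t = H (A t u) (e j)" for t
  define \<alpha> where "\<alpha> = a' j"
  have eV: "\<And>i. i < n \<Longrightarrow> e i \<in> V" using e(1) by (auto simp: orthonormal_def)
  have ejj: "H (e j) (e j) = 1" using e(1) j by (auto simp: orthonormal_def)
  note T = clin_onD[OF A]
  have AuV: "A t u \<in> V" if "t \<in> S" for t using T(2) that u(1) by blast
  have Aej: "A t (e j) = cmul J (\<alpha> t) (e j)" if "t \<in> S" for t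
    using e(2)[OF that j] by (simp add: \<alpha>_def)
  have u_e: "H (e i) u = 0" if "i < n" for i
    using u(3)[OF that] H_cnj[OF u(1) eV[OF that]] by simp
  have pu: "H (proj n e x) u = 0" for x
    unfolding proj_def using eV u(1) u_e by (subst H_sum) (auto simp: H_cmul)
  \<comment> \<open>The span of the \<open>e i\<close> is invariant, and on it the component along
    \<open>e j\<close> is multiplied by its own eigenvalue.\<close>
  have Apu: "H (A t (proj n e x)) u = 0" "H (A t (proj n e x)) (e j) = \<alpha> t * H x (e j)"
    if t: "t \<in> S" and x: "x \<in> V" for t x
  proof -
    have "A t (proj n e x) = (\<Sum>i<n. cmul J (H x (e i) * a' i t) (e i))"
      unfolding proj_def using eV
      by (subst lin_on_sum[OF T(1)[OF t] V_subspace]) (auto simp: T(5)[OF t] e(2)[OF t] cmul_cmul)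
    then have *: "H (A t (proj n e x)) z = (\<Sum>i<n. H x (e i) * a' i t * H (e i) z)" if "z \<in> V" for z
      using that eV by (simp only:) (subst H_sum, auto simp: H_cmul)
    show "H (A t (proj n e x)) u = 0" using *[OF u(1)] u_e by simp
    have "H (A t (proj n e x)) (e j) = (\<Sum>i<n. if i = j then H x (e i) * a' i t else 0)"
      unfolding *[OF eV[OF j]] using e(1) j by (intro sum.cong) (auto simp: orthonormal_def)
    then show "H (A t (proj n e x)) (e j) = \<alpha> t * H x (e j)" using j by (simp add: \<alpha>_def)
  qed
  have Hu: "H (A t u) u = a t" if "t \<in> S" for t
    using Au[OF that] AuV[OF that] u(1,2) proj_in[OF e(1)] by (metis H_add H_cmul cmul_in pu add.right_neutral mult.right_neutral)
  have AAu: "A t (A r u) = cmul J (a r) (A t u) + A t (proj n e (A r u))" if "t \<in> S" "r \<in> S" for t r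
    using T(3)[OF that(1), of "cmul J (a r) u" "proj n e (A r u)"] Au[OF that(2)] u(1)
      proj_in[OF e(1) AuV[OF that(2)]] T(5)[OF that(1)] by simp
  have inV: "A t (proj n e (A r u)) \<in> V" if "t \<in> S" "r \<in> S" for t r
    using T(2)[OF that(1)] proj_in[OF e(1) AuV[OF that(2)]] by blast
  \<comment> \<open>Off-diagonal entry of a product of triangular matrices; comparing both orders of
    \<open>s\<close> and \<open>f s\<close> will give \<open>cc\<close>.\<close>
  have AAe: "H (A t (A r u)) (e j) = a r * b t + \<alpha> t * b r" if "t \<in> S" "r \<in> S" for t r
    using that eV[OF j] AuV inV Apu(2) by (simp add: AAu H_add H_cmul b_def)
  have AAu': "H (A t (A r u)) u = a r * a t" if "t \<in> S" "r \<in> S" for t r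
    using that u(1) AuV inV Apu(1) Hu by (simp add: AAu H_add H_cmul)
  \<comment> \<open>Only the components along \<open>u\<close> and \<open>e j\<close> are kept. The
    remainder \<open>w\<close> contributes a nonnegative square, hence an inequality.\<close>
  have norm: "g (A s u) (A s u) \<ge> (cmod (a s))\<^sup>2 + (cmod (b s))\<^sup>2"
  proof -
    define w where "w = A s u - cmul J (a s) u - cmul J (b s) (e j)"
    have wV: "w \<in> V" using AuV[OF s] u(1) eV[OF j] by (auto simp: w_def)
    have wu: "H w u = 0" "H w (e j) = 0"
      using AuV[OF s] u eV[OF j] u_e[OF j] ejj Hu[OF s]
      by (auto simp: w_def H_diff H_cmul b_def j)
    have wu': "H u w = 0" "H (e j) w = 0"
      using wu H_cnj[OF wV u(1)] H_cnj[OF wV eV[OF j]] by simp_all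
    have d: "A s u = cmul J (a s) u + cmul J (b s) (e j) + w" by (simp add: w_def)
    have "H (A s u) (A s u) = a s * cnj (a s) + b s * cnj (b s) + H w w"
      unfolding d using u eV[OF j] wV wu wu' u_e[OF j] ejj j
      by (simp add: H_add H_add_right H_cmul H_cmul_right)
    then have "g (A s u) (A s u) = (cmod (a s))\<^sup>2 + (cmod (b s))\<^sup>2 + g w w"
      unfolding Re_H_self[symmetric] cmod_power2 by (simp add: power2_eq_square)
    moreover have "g w w \<ge> 0"
      using g_pos[OF wV] g_zero[OF V_zero] by (cases "w = 0") auto
    ultimately show ?thesis by linarith
  qed
  have ev: "H (e j) (A t (A t (e j))) = cnj (\<alpha> t * \<alpha> t)" "H u (A t (A t (e j))) = 0"
     "H (A t (A t (e j))) (e j) = \<alpha> t * \<alpha> t" if "t \<in> S" for t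
    using that eV[OF j] u(1) u(3)[OF j] ejj
    by (auto simp: Aej T(5)[OF that] H_cmul H_cmul_right cmul_cmul)
  \<comment> \<open>\<open>eq\<close> at the pair \<open>e j\<close>, \<open>e j\<close>: the real
    part of the square of \<open>\<alpha> s\<close> plus its squared modulus is
    \<open>2 * (Re (\<alpha> s))\<^sup>2\<close>.\<close>
  have cj: "Re (\<alpha> (f s)) = - 2 * (Re (\<alpha> s))\<^sup>2"
  proof -
    have "H (A (f s) (e j)) (e j) + H (e j) (A (f s) (e j)) + H (A s (A s (e j))) (e j) + H (e j) (A s (A s (e j)))
          + 2 * H (A s (e j)) (A s (e j)) = 0" using eq[OF s eV[OF j] eV[OF j]] .
    then have "\<alpha> (f s) + cnj (\<alpha> (f s)) + \<alpha> s * \<alpha> s + cnj (\<alpha> s * \<alpha> s) + 2 * (\<alpha> s * cnj (\<alpha> s)) = 0"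
      unfolding ev[OF s] using f[OF s] s eV[OF j] ejj by (simp add: Aej H_cmul H_cmul_right mult.commute)
    then show ?thesis by (simp add: complex_eq_iff power2_eq_square)
  qed
  have cu: "Re (a (f s)) \<le> - 2 * (Re (a s))\<^sup>2 - (cmod (b s))\<^sup>2"
  proof -
    have x: "H u (A t u) = cnj (a t)" "H u (A t (A t u)) = cnj (a t * a t)" if "t \<in> S" for t
      using H_cnj[OF AuV[OF that] u(1)] H_cnj[OF T(2)[OF that AuV[OF that]] u(1)]
        Hu[OF that] AAu'[OF that that] by simp_all
    have "Re (a (f s) + cnj (a (f s)) + a s * a s + cnj (a s * a s) + 2 * H (A s u) (A s u)) = 0"
      using eq[OF s u(1) u(1)] x s f[OF s] Hu AAu' by simp
    then have "Re (a (f s)) + (Re (a s))\<^sup>2 - (Im (a s))\<^sup>2 + g (A s u) (A s u) = 0"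
      by (simp add: Re_H_self power2_eq_square)
    then show ?thesis using norm unfolding cmod_power2[of "a s"] by linarith
  qed
  \<comment> \<open>\<open>eq\<close> at the pair \<open>u\<close>, \<open>e j\<close>: the terms
    with plain \<open>u\<close> on the left vanish, as \<open>e j\<close> is an eigenvector
    orthogonal to \<open>u\<close>.\<close>
  have cb: "b (f s) = - (2 * of_real (Re (\<alpha> s)) + a s + cnj (\<alpha> s)) * b s"
  proof -
    have "b (f s) + (a s * b s + \<alpha> s * b s) + 2 * (cnj (\<alpha> s) * b s) = 0"
      using eq[OF s u(1) eV[OF j]] s f[OF s] eV[OF j] u(1) u(3)[OF j] AuV[OF s]
      by (simp add: AAe ev b_def[symmetric] Aej[OF f[OF s]] H_cmul_right Aej[OF s] T(5)[OF s]
          cmul_cmul)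
    then show ?thesis by (simp add: complex_eq_iff algebra_simps)
  qed
  define c where "c t = a t - \<alpha> t" for t
  have cc: "c (f s) * b s = c s * b (f s)"
    using AAe[OF s f[OF s]] AAe[OF f[OF s] s] comm[OF s f[OF s] u(1)]
    by (simp add: c_def algebra_simps)
  have bs: "b s \<noteq> 0" using nz by (simp add: b_def)
  have "c (f s) = - (2 * of_real (Re (\<alpha> s)) + a s + cnj (\<alpha> s)) * c s"
    using cc bs unfolding cb by (simp add: mult.commute mult.left_commute)
  also have "2 * of_real (Re (\<alpha> s)) + a s + cnj (\<alpha> s) = of_real (4 * Re (\<alpha> s)) + c s"
    by (simp add: c_def complex_eq_iff)
  finally have "Re (c (f s)) = - (4 * Re (\<alpha> s) + Re (c s)) * Re (c s) + (Im (c s))\<^sup>2"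
    by (simp add: power2_eq_square)
  moreover have "Re (c (f s)) \<le> - 2 * (Re (a s))\<^sup>2 - (cmod (b s))\<^sup>2 + 2 * (Re (\<alpha> s))\<^sup>2"
    using cj cu by (simp add: c_def)
  \<comment> \<open>With \<open>a = \<alpha> + c\<close>, the term
    \<open>4 * Re \<alpha> * Re c\<close> occurs on both sides and cancels; only squares
    remain.\<close>
  ultimately have "(Re (c s))\<^sup>2 + (Im (c s))\<^sup>2 + (cmod (b s))\<^sup>2 \<le> 0"
    by (simp add: c_def power2_eq_square algebra_simps)
  moreover have "(cmod (b s))\<^sup>2 > 0" using bs by simp
  ultimately show False by (smt (verit) zero_le_power2)
qed

text \<open>A longest orthonormal family of common eigenvectors must span \<open>V\<close>. If its
  complement \<open>W\<close> were nonzero, the compressed maps would share an eigenvector there,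
  and \<open>compressed_eigenvector\<close> would make it an eigenvector of the original maps,
  lengthening the family.\<close>

lemma simultaneous_diagonalization:
  assumes A: "\<And>s. s \<in> S \<Longrightarrow> clin_on V J (A s)"
    and comm: "\<And>s t x. s \<in> S \<Longrightarrow> t \<in> S \<Longrightarrow> x \<in> V \<Longrightarrow> A s (A t x) = A t (A s x)"
    and f: "\<And>s. s \<in> S \<Longrightarrow> f s \<in> S"
    and eq: "\<And>s y z. s \<in> S \<Longrightarrow> y \<in> V \<Longrightarrow> z \<in> V \<Longrightarrow>
        H (A (f s) y) z + H y (A (f s) z) + H (A s (A s y)) z + H y (A s (A s z))
          + 2 * H (A s y) (A s z) = 0"
  obtains n e a where "orthonormal n e"
    "\<And>s i. s \<in> S \<Longrightarrow> i < n \<Longrightarrow> A s (e i) = cmul J (a i s) (e i)"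
    "\<And>x. x \<in> V \<Longrightarrow> proj n e x = x"
proof -
  note T = clin_onD[OF A]
  define P where "P n \<longleftrightarrow> (\<exists>e a. orthonormal n e \<and> (\<forall>s\<in>S. \<forall>i<n. A s (e i) = cmul J (a i s) (e i)))"
    for n
  obtain B where B: "finite B" "span B = V" using fin_dim by (auto simp: fin_dim_space_def)
  have P0: "P 0" by (auto simp: P_def orthonormal_def)
  have Pb: "\<And>n. P n \<Longrightarrow> n \<le> card B" using orthonormal_bound[OF B] by (auto simp: P_def)
  obtain n where n: "P n" "\<And>k. P k \<Longrightarrow> k \<le> n"
    using Nat.ex_has_greatest_nat[of P 0 "card B"] P0 Pb by blast
  then obtain e a where e: "orthonormal n e"
    "\<And>s i. s \<in> S \<Longrightarrow> i < n \<Longrightarrow> A s (e i) = cmul J (a i s) (e i)"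
    by (auto simp: P_def)
  then have eV: "\<And>i. i < n \<Longrightarrow> e i \<in> V" by (auto simp: orthonormal_def)
  define W where "W = {x \<in> V. \<forall>i<n. H x (e i) = 0}"
  have sW: "subspace W"
    using eV by (auto simp: W_def subspace_def H_add H_scale H_zero)
  have cW: "complex_space W J"
    by (rule complex_space_subset[OF complex_space_axioms sW]) (auto simp: W_def H_J eV)
  have Wproj: "x - proj n e x \<in> W" if "x \<in> V" for x
    using that eV H_proj[OF e(1) that] proj_in[OF e(1) that] by (auto simp: W_def H_diff)
  have projW: "proj n e x = 0" if "x \<in> W" for x
    using that by (auto simp: proj_def W_def intro!: sum.neutral)
  have W0: "W = {0}"
  proof (rule ccontr)
    assume nz: "W \<noteq> {0}"
    note p = clin_onD[OF proj_clin[OF e(1)]]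
    define C where "C s x = A s x - proj n e (A s x)" for s x
    have CW: "C s x \<in> W" if "s \<in> S" "x \<in> V" for s x
      unfolding C_def using that by (intro Wproj T(2))
    have lCV: "clin_on V J (C s)" if s: "s \<in> S" for s
    proof -
      have "C s x \<in> V" if "x \<in> V" for x using CW[OF s that] by (simp add: W_def)
      moreover have "C s (x + y) = C s x + C s y" if "x \<in> V" "y \<in> V" for x y
        using that by (simp add: C_def T(2,3)[OF s] p(3))
      moreover have "C s (r *\<^sub>R x) = r *\<^sub>R C s x" if "x \<in> V" for x r
        using that T(5)[OF s that, of "of_real r"] p(5)[of "A s x" "of_real r"] T(2)[OF s that]
        by (simp add: C_def cmul_of_real scaleR_diff_right)
      moreover have "C s (J x) = J (C s x)" if "x \<in> V" for x
        using that T(2)[OF s that] p(2) by (simp add: C_def T(4)[OF s] p(4) J_diff)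
      ultimately show ?thesis by (simp add: clin_on_def lin_on_def)
    qed
    have lC: "clin_on W J (C s)" if "s \<in> S" for s
      using CW[OF that] lCV[OF that] unfolding clin_on_def lin_on_def W_def by simp
    \<comment> \<open>The span of the \<open>e i\<close> is invariant, so compression kills its
      image. Hence a composite of compressions is the compression of the composite
      (\<open>CC\<close>), and compressions commute.\<close>
    have Cp: "C s (proj n e x) = 0" if s: "s \<in> S" and x: "x \<in> V" for s x
    proof -
      have "C s (e i) = 0" if "i < n" for i
        using e(2)[OF s that] p(5)[OF eV[OF that]] proj_base[OF e(1) that] by (simp add: C_def)
      then show ?thesis
        unfolding proj_def using eV
        by (subst lin_on_sum[OF clin_onD(1)[OF lCV[OF s]] V_subspace])
          (auto simp: clin_onD(5)[OF lCV[OF s]])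
    qed
    have CC: "C s (C t x) = A s (A t x) - proj n e (A s (A t x))" if "s \<in> S" "t \<in> S" "x \<in> W" for s t x
    proof -
      have x: "x \<in> V" "A t x \<in> V" using that T(2) by (auto simp: W_def)
      have "C s (A t x - proj n e (A t x)) = C s (A t x) - C s (proj n e (A t x))"
        by (rule lin_on_diff[OF V_subspace clin_onD(1)[OF lCV[OF that(1)]] x(2) p(2)[OF x(2)]])
      then have "C s (C t x) = C s (A t x)" using Cp[OF that(1) x(2)] by (simp add: C_def[of t])
      then show ?thesis by (simp add: C_def[of s])
    qed
    have Ccomm: "C s (C t x) = C t (C s x)" if "s \<in> S" "t \<in> S" "x \<in> W" for s t x
      using that comm[of s t x] by (simp add: CC) (simp add: W_def)
    have fW: "fin_dim_space W"
      by (rule fin_dim_space_subspace[OF sW _ fin_dim]) (auto simp: W_def)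
    obtain v where v: "v \<in> W" "v \<noteq> 0" "\<And>s. s \<in> S \<Longrightarrow> \<exists>c. C s v = cmul J c v"
      using common_eigenvector[where S = S and A = C, OF cW fW nz lC Ccomm] by auto
    define u where "u = cmul J (of_real (1 / sqrt (g v v))) v"
    have vV: "v \<in> V" using v by (auto simp: W_def)
    have gv: "g v v > 0" using g_pos[OF vV v(2)] .
    have uV: "u \<in> V" using vV by (simp add: u_def)
    have uW: "H u (e i) = 0" if "i < n" for i
      using v(1) that eV[OF that] vV by (auto simp: u_def W_def H_cmul)
    have "g u u = 1 / sqrt (g v v) * (1 / sqrt (g v v)) * g v v"
      using vV by (simp only: u_def cmul_of_real g_scale g_scale_right V_scale mult.assoc)
    also have "\<dots> = 1" using gv by simp
    finally have uu: "H u u = 1" using H_self[OF uV] by simp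
    have "\<exists>c. A s u = cmul J c u + proj n e (A s u)" if s: "s \<in> S" for s
    proof -
      obtain c where c: "C s v = cmul J c v" using v(3)[OF s] by blast
      let ?r = "of_real (1 / sqrt (g v v))"
      have "A s u - proj n e (A s u) = cmul J ?r (C s v)"
        unfolding u_def C_def using vV T(2)[OF s vV] p(2)
        by (simp only: T(5)[OF s] p(5) lin_on_diff[OF V_subspace cmul_lin])
      also have "\<dots> = cmul J c u" using vV by (simp add: c u_def cmul_cmul mult.commute)
      finally show ?thesis by (metis diff_add_cancel)
    qed
    then obtain d where d: "\<And>s. s \<in> S \<Longrightarrow> A s u = cmul J (d s) u + proj n e (A s u)" by metis
    have "H (A s u) (e j) = 0" if "s \<in> S" "j < n" for s j
      by (rule compressed_eigenvector[where S = S and A = A and f = f, OF A comm f eq e uV uu uW d that]) auto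
    then have "proj n e (A s u) = 0" if "s \<in> S" for s
      using that by (auto simp: proj_def intro!: sum.neutral)
    then have dA: "A s u = cmul J (d s) u" if "s \<in> S" for s using d[OF that] that by simp
    have uW': "H (e i) u = 0" if "i < n" for i
      using uW[OF that] H_cnj[OF uV eV[OF that]] by simp
    have "orthonormal (Suc n) (e(n := u))"
      using e(1) uV uu uW uW' by (auto simp: orthonormal_def less_Suc_eq)
    moreover have "A s ((e(n := u)) i) = cmul J ((a(n := d)) i s) ((e(n := u)) i)"
      if "s \<in> S" "i < Suc n" for s i
      using dA e(2) that by (auto simp: less_Suc_eq)
    ultimately have "P (Suc n)" unfolding P_def by blast
    then show False using n(2) by fastforce
  qed
  have "proj n e x = x" if "x \<in> V" for x using Wproj[OF that] W0 by simp
  then show ?thesis using that e by blast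
qed

end

section \<open>The Lie algebras \<open>\<gg>\<^sub>f\<^sub>,\<^sub>h\<^sub>,\<^sub>\<alpha>\<close>\<close>

lemma bilin_onD:
  assumes "bilin_on S T U b"
  shows "x \<in> S \<Longrightarrow> y \<in> T \<Longrightarrow> b x y \<in> U"
    and "x \<in> S \<Longrightarrow> x' \<in> S \<Longrightarrow> y \<in> T \<Longrightarrow> b (x + x') y = b x y + b x' y"
    and "x \<in> S \<Longrightarrow> y \<in> T \<Longrightarrow> y' \<in> T \<Longrightarrow> b x (y + y') = b x y + b x y'"
    and "x \<in> S \<Longrightarrow> y \<in> T \<Longrightarrow> b (r *\<^sub>R x) y = r *\<^sub>R b x y"
    and "x \<in> S \<Longrightarrow> y \<in> T \<Longrightarrow> b x (r *\<^sub>R y) = r *\<^sub>R b x y"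
  using assms by (auto simp: bilin_on_def lin_on_def)

lemma bilin_on_subspace:
  assumes b: "bilin_on S T U b" and S: "subspace S" and T: "subspace T"
  shows "y \<in> T \<Longrightarrow> b 0 y = 0"
    and "x \<in> S \<Longrightarrow> b x 0 = 0"
    and "x \<in> S \<Longrightarrow> y \<in> T \<Longrightarrow> b (- x) y = - b x y"
    and "x \<in> S \<Longrightarrow> y \<in> T \<Longrightarrow> b x (- y) = - b x y"
    and "x \<in> S \<Longrightarrow> x' \<in> S \<Longrightarrow> y \<in> T \<Longrightarrow> b (x - x') y = b x y - b x' y"
    and "x \<in> S \<Longrightarrow> y \<in> T \<Longrightarrow> y' \<in> T \<Longrightarrow> b x (y - y') = b x y - b x y'"
proof -
  have l: "\<And>y. y \<in> T \<Longrightarrow> lin_on S U (\<lambda>x. b x y)" "\<And>x. x \<in> S \<Longrightarrow> lin_on T U (b x)"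
    using b by (auto simp: bilin_on_def)
  show "y \<in> T \<Longrightarrow> b 0 y = 0" "x \<in> S \<Longrightarrow> b x 0 = 0"
    using lin_on_zero[OF S l(1)] lin_on_zero[OF T l(2)] by auto
  show "x \<in> S \<Longrightarrow> y \<in> T \<Longrightarrow> b (- x) y = - b x y" "x \<in> S \<Longrightarrow> y \<in> T \<Longrightarrow> b x (- y) = - b x y"
    using lin_on_minus[OF S l(1)] lin_on_minus[OF T l(2)] by auto
  show "x \<in> S \<Longrightarrow> x' \<in> S \<Longrightarrow> y \<in> T \<Longrightarrow> b (x - x') y = b x y - b x' y"
    "x \<in> S \<Longrightarrow> y \<in> T \<Longrightarrow> y' \<in> T \<Longrightarrow> b x (y - y') = b x y - b x y'"
    using lin_on_diff[OF S l(1)] lin_on_diff[OF T l(2)] by auto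
qed

lemma cscale_eq_cmul: "cscale D = cmul (mul_i D)"
  by (auto simp: fun_eq_iff cscale_def cmul_def)

locale gfh_space =
  fixes D :: "('c::real_vector, 'v::real_vector) gfh_data"
  assumes valid: "gfh_valid D"
begin

lemma basis: "complex_space_basis D"
  and ar_fin_dim: "fin_dim_space (ar D)"
  and f_bilin: "bilin_on (ar D) (ar D) (ar D) (fmap D)"
  and hsym_bilin: "bilin_on (ar D) (ar D) (aJ D) (hsym D)"
  and halt_bilin: "bilin_on (ar D) (ar D) (aJ D) (halt D)"
  and g0_bilin: "bilin_on (ar D) (ar D) UNIV (gzero D)"
  and tau_bilin: "bilin_on (ar D) (ar D) UNIV (tauzero D)"
  and symmetric: "symmetric_on (ar D) (fmap D)" "symmetric_on (ar D) (hsym D)"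
    "symmetric_on (ar D) (gzero D)"
  and antisymmetric: "antisymmetric_on (ar D) (halt D)" "antisymmetric_on (ar D) (tauzero D)"
  and alp_lin: "i < dimJ D \<Longrightarrow> lin_on (ar D) UNIV (alp D i)"
  and f_f: "x \<in> ar D \<Longrightarrow> y \<in> ar D \<Longrightarrow> z \<in> ar D \<Longrightarrow> fmap D (fmap D x y) z = fmap D (fmap D x z) y"
  and met_pos: "p \<in> gfh_carr D \<Longrightarrow> p \<noteq> 0 \<Longrightarrow> gfh_met D p p > 0"
  using valid[unfolded gfh_valid_def] by (fast elim: conjE)+

lemma f_sym: "x \<in> ar D \<Longrightarrow> y \<in> ar D \<Longrightarrow> fmap D x y = fmap D y x"
  and hsym_sym: "x \<in> ar D \<Longrightarrow> y \<in> ar D \<Longrightarrow> hsym D x y = hsym D y x"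
  and g0_sym: "x \<in> ar D \<Longrightarrow> y \<in> ar D \<Longrightarrow> gzero D x y = gzero D y x"
  using symmetric unfolding symmetric_on_def by blast+

lemma halt_antisym: "x \<in> ar D \<Longrightarrow> y \<in> ar D \<Longrightarrow> halt D x y = - halt D y x"
  and tau_antisym: "x \<in> ar D \<Longrightarrow> y \<in> ar D \<Longrightarrow> tauzero D x y = - tauzero D y x"
  using antisymmetric unfolding antisymmetric_on_def by blast+

sublocale complex_space "aJ D" "mul_i D"
  using basis by unfold_locales (simp_all add: complex_space_basis_def)

lemma ar_subspace: "subspace (ar D)"
  using ar_fin_dim unfolding fin_dim_space_def by (metis subspace_span)

lemma ar_add [simp]: "x \<in> ar D \<Longrightarrow> y \<in> ar D \<Longrightarrow> x + y \<in> ar D"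
  and ar_diff [simp]: "x \<in> ar D \<Longrightarrow> y \<in> ar D \<Longrightarrow> x - y \<in> ar D"
  and ar_scale [simp]: "x \<in> ar D \<Longrightarrow> r *\<^sub>R x \<in> ar D"
  and ar_minus [simp]: "x \<in> ar D \<Longrightarrow> - x \<in> ar D"
  and ar_zero [simp]: "0 \<in> ar D"
  using ar_subspace
  by (auto simp: subspace_add subspace_diff subspace_scale subspace_neg subspace_0)

lemma baseY_in [simp]: "i < dimJ D \<Longrightarrow> baseY D i \<in> aJ D"
  using basis by (auto simp: complex_space_basis_def)

lemma cexpansion_coordJ:
  assumes "y \<in> aJ D"
  shows "cexpansion D y (\<lambda>i. coordJ D i y)"
proof -
  have "\<exists>!c. cexpansion D y c" using basis assms by (auto simp: complex_space_basis_def)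
  then have "cexpansion D y (THE c. cexpansion D y c)" by (rule theI')
  then show ?thesis by (simp add: coordJ_def)
qed

lemma aJ_expansion: "y \<in> aJ D \<Longrightarrow> y = (\<Sum>i<dimJ D. cmul (mul_i D) (coordJ D i y) (baseY D i))"
  using cexpansion_coordJ by (simp add: cexpansion_def cscale_eq_cmul)

text \<open>Reduces identities in \<open>aJ D\<close> to scalar ones, in which the action is
  multiplication by \<open>alp D i\<close>.\<close>

lemma aJ_eqI:
  assumes "x \<in> aJ D" "y \<in> aJ D" "\<And>i. i < dimJ D \<Longrightarrow> coordJ D i x = coordJ D i y"
  shows "x = y"
  using aJ_expansion[OF assms(1)] aJ_expansion[OF assms(2)] assms(3) by simp

lemma coordJ_sum_basis:
  assumes "\<And>i. i \<ge> dimJ D \<Longrightarrow> c i = 0"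
  shows "coordJ D j (\<Sum>i<dimJ D. cmul (mul_i D) (c i) (baseY D i)) = c j"
  by (rule coordJ_eqI[OF basis]) (use assms in \<open>auto simp: cexpansion_def cscale_eq_cmul\<close>)

lemma coordJ_add:
  assumes "x \<in> aJ D" "y \<in> aJ D"
  shows "coordJ D i (x + y) = coordJ D i x + coordJ D i y"
  by (rule coordJ_eqI[OF basis])
    (use assms cexpansion_coordJ in
      \<open>auto simp: cexpansion_def cscale_eq_cmul cmul_add_left sum.distrib\<close>)

lemma coordJ_cmul:
  assumes "x \<in> aJ D"
  shows "coordJ D i (cmul (mul_i D) c x) = c * coordJ D i x"
proof (rule coordJ_eqI[OF basis])
  have "cmul (mul_i D) c x = cmul (mul_i D) c (\<Sum>i<dimJ D. cmul (mul_i D) (coordJ D i x) (baseY D i))"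
    using aJ_expansion[OF assms] by simp
  also have "\<dots> = (\<Sum>i<dimJ D. cmul (mul_i D) (c * coordJ D i x) (baseY D i))"
    by (subst cmul_sum) (auto simp: cmul_cmul)
  finally show "cexpansion D (cmul (mul_i D) c x) (\<lambda>i. c * coordJ D i x)"
    using cexpansion_coordJ[OF assms] by (simp add: cexpansion_def cscale_eq_cmul)
qed (use assms in auto)

lemma coordJ_scale: "x \<in> aJ D \<Longrightarrow> coordJ D i (r *\<^sub>R x) = of_real r * coordJ D i x"
  and coordJ_mul_i: "x \<in> aJ D \<Longrightarrow> coordJ D i (mul_i D x) = \<i> * coordJ D i x"
  and coordJ_minus: "x \<in> aJ D \<Longrightarrow> coordJ D i (- x) = - coordJ D i x"
  using coordJ_cmul[of x i "of_real r"] coordJ_cmul[of x i \<i>] coordJ_cmul[of x i "of_real (- 1)"]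
  by (simp_all add: cmul_of_real cmul_i) (simp add: cmul_def)

lemma coordJ_diff: "x \<in> aJ D \<Longrightarrow> y \<in> aJ D \<Longrightarrow> coordJ D i (x - y) = coordJ D i x - coordJ D i y"
  using coordJ_add[of x "- y" i] coordJ_minus[of y i] by simp

lemmas coordJ_simps = coordJ_add coordJ_cmul coordJ_scale coordJ_mul_i coordJ_minus coordJ_diff
  coordJ_zero[OF basis]

lemma actJ_in [simp]: "actJ D z y \<in> aJ D"
  by (auto simp: actJ_def cscale_eq_cmul)

lemma coordJ_actJ:
  assumes "i < dimJ D" "y \<in> aJ D"
  shows "coordJ D i (actJ D z y) = alp D i z * coordJ D i y"
  unfolding actJ_def cscale_eq_cmul
  using coordJ_sum_basis[of "\<lambda>i. alp D i z * coordJ D i y"] cexpansion_coordJ[OF assms(2)]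
  by (simp add: cexpansion_def)

lemma actJ_bilin: "bilin_on (ar D) (aJ D) (aJ D) (actJ D)"
proof -
  have alp: "alp D i (x + y) = alp D i x + alp D i y" "alp D i (r *\<^sub>R x) = of_real r * alp D i x"
    if "i < dimJ D" "x \<in> ar D" "y \<in> ar D" for i x y r
    using alp_lin[OF that(1)] that(2,3) by (auto simp: lin_on_def scaleR_conv_of_real)
  show ?thesis
    unfolding bilin_on_def lin_on_def
    by (auto intro!: aJ_eqI simp: coordJ_actJ coordJ_simps alp algebra_simps)
qed

lemma hmap_bilin: "bilin_on (ar D) (ar D) (aJ D) (hmap D)"
  unfolding bilin_on_def lin_on_def
  by (auto simp: hmap_def bilin_onD[OF hsym_bilin] bilin_onD[OF halt_bilin] algebra_simps)

lemmas brk_in = bilin_onD(1)[OF f_bilin] bilin_onD(1)[OF hmap_bilin] bilin_onD(1)[OF halt_bilin]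

lemma gfh_brk_in: "p \<in> gfh_carr D \<Longrightarrow> q \<in> gfh_carr D \<Longrightarrow> gfh_brk D p q \<in> gfh_carr D"
  by (cases p; cases q) (simp add: gfh_carr_def brk_in cscale_eq_cmul)

lemma gfh_brk_antisym:
  assumes "p \<in> gfh_carr D" "q \<in> gfh_carr D"
  shows "gfh_brk D p q = - gfh_brk D q p"
proof (cases p; cases q)
  fix y x z y' x' z' assume pq: "p = (y, x, z)" "q = (y', x', z')"
  then have z: "z \<in> ar D" "z' \<in> ar D" using assms by (auto simp: gfh_carr_def)
  have "cmul (mul_i D) (2 * \<i>) (halt D z z') = - cmul (mul_i D) (2 * \<i>) (halt D z' z)"
    using lin_on_minus[OF V_subspace cmul_lin] halt_antisym[OF z] brk_in(3)[OF z(2,1)] by simp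
  then show ?thesis by (simp add: pq cscale_eq_cmul)
qed

lemma gfh_carr_subspace: "subspace (gfh_carr D)"
  by (auto simp: gfh_carr_def subspace_def zero_prod_def)

lemma gfh_brk_bilin: "bilin_on (gfh_carr D) (gfh_carr D) (gfh_carr D) (gfh_brk D)"
proof -
  have lin: "lin_on (gfh_carr D) (gfh_carr D) (gfh_brk D p)" if p: "p \<in> gfh_carr D" for p
  proof -
    obtain y x z where p': "p = (y, x, z)" "y \<in> aJ D" "x \<in> ar D" "z \<in> ar D"
      using p by (cases p) (auto simp: gfh_carr_def)
    have "gfh_brk D p (q + r) = gfh_brk D p q + gfh_brk D p r"
      if "q \<in> gfh_carr D" "r \<in> gfh_carr D" for q r
      using that p' bilin_onD[OF actJ_bilin] bilin_onD[OF hmap_bilin] bilin_onD[OF halt_bilin]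
        bilin_onD[OF f_bilin]
      by (cases q; cases r) (simp add: gfh_carr_def cscale_eq_cmul cmul_add)
    moreover have "gfh_brk D p (t *\<^sub>R q) = t *\<^sub>R gfh_brk D p q" if "q \<in> gfh_carr D" for q t
      using that p' bilin_onD[OF actJ_bilin] bilin_onD[OF hmap_bilin] bilin_onD[OF halt_bilin]
        bilin_onD[OF f_bilin] cmul_lin[of "2 * \<i>"]
      by (cases q) (simp add: gfh_carr_def cscale_eq_cmul lin_on_def scaleR_right_distrib scaleR_diff_right)
    ultimately show ?thesis using gfh_brk_in[OF p] by (auto simp: lin_on_def)
  qed
  have "lin_on (gfh_carr D) (gfh_carr D) (\<lambda>p. gfh_brk D p q)" if q: "q \<in> gfh_carr D" for q
  proof -
    have s: "gfh_brk D p q = - gfh_brk D q p" if "p \<in> gfh_carr D" for p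
      using gfh_brk_antisym[OF that q] .
    then show ?thesis
      using lin[OF q] gfh_brk_in[OF _ q] gfh_carr_subspace
      unfolding lin_on_def by (simp add: subspace_add subspace_scale)
  qed
  then show ?thesis using lin by (auto simp: bilin_on_def)
qed

text \<open>Every bracket has last component zero, so in a double bracket the \<open>halt\<close>
  term of the outer one drops out.\<close>

lemma gfh_brk_nested:
  assumes "y \<in> aJ D" "x \<in> ar D" "z \<in> ar D" "y' \<in> aJ D" "x' \<in> ar D"
  shows "gfh_brk D (y, x, z) (y', x', 0) = (actJ D z y' + hmap D z x', fmap D z x', 0)"
  using assms bilin_on_subspace[OF actJ_bilin ar_subspace V_subspace]
    bilin_on_subspace[OF hmap_bilin ar_subspace ar_subspace]
    bilin_on_subspace[OF halt_bilin ar_subspace ar_subspace]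
    bilin_on_subspace[OF f_bilin ar_subspace ar_subspace]
  by (simp add: cscale_eq_cmul)

text \<open>The component in \<open>ar D\<close> vanishes by total symmetry of
  \<open>f (f X Y) Z\<close>. In each coordinate of \<open>aJ D\<close>, the terms in the
  \<open>y\<close> cancel because the action is diagonal, those in the \<open>x\<close> are governed
  by the first equation, and those in the \<open>z\<close> alone by the second.\<close>

lemma gfh_jacobi:
  assumes eqs: "gfh_equations D"
    and "p \<in> gfh_carr D" "q \<in> gfh_carr D" "r \<in> gfh_carr D"
  shows "gfh_brk D p (gfh_brk D q r) + gfh_brk D q (gfh_brk D r p) + gfh_brk D r (gfh_brk D p q) = 0"
proof -
  obtain y\<^sub>1 x\<^sub>1 z\<^sub>1 y\<^sub>2 x\<^sub>2 z\<^sub>2 y\<^sub>3 x\<^sub>3 z\<^sub>3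
    where p: "p = (y\<^sub>1, x\<^sub>1, z\<^sub>1)" "q = (y\<^sub>2, x\<^sub>2, z\<^sub>2)" "r = (y\<^sub>3, x\<^sub>3, z\<^sub>3)"
      and y: "y\<^sub>1 \<in> aJ D" "y\<^sub>2 \<in> aJ D" "y\<^sub>3 \<in> aJ D"
      and x: "x\<^sub>1 \<in> ar D" "x\<^sub>2 \<in> ar D" "x\<^sub>3 \<in> ar D"
      and z: "z\<^sub>1 \<in> ar D" "z\<^sub>2 \<in> ar D" "z\<^sub>3 \<in> ar D"
    using assms(2-4) by (cases p; cases q; cases r) (auto simp: gfh_carr_def)
  define B where "B z y x z' y' x' =
    actJ D z y' - actJ D z' y + hmap D z x' - hmap D z' x + cscale D (2 * \<i>) (halt D z z')"
    for z y x z' y' x'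
  define F where "F z x z' x' = fmap D z x' - fmap D z' x" for z x z' x'
  have F_in: "F z x z' x' \<in> ar D" and B_in: "B z y x z' y' x' \<in> aJ D"
    if "z \<in> ar D" "x \<in> ar D" "z' \<in> ar D" "x' \<in> ar D" for z x z' x' y y'
    using that by (auto simp: F_def B_def brk_in cscale_eq_cmul)
  have nested: "gfh_brk D (y, x, z) (gfh_brk D (y', x', z') (y'', x'', z''))
      = (actJ D z (B z' y' x' z'' y'' x'') + hmap D z (F z' x' z'' x''), fmap D z (F z' x' z'' x''), 0)"
    if "y \<in> aJ D" "x \<in> ar D" "z \<in> ar D" "z' \<in> ar D" "x' \<in> ar D" "z'' \<in> ar D" "x'' \<in> ar D"
    for y x z y' x' z' y'' x'' z''
    using gfh_brk_nested[OF that(1-3), of "B z' y' x' z'' y'' x''" "F z' x' z'' x''"] that F_in B_in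
    by (simp add: B_def F_def)
  have f3: "fmap D z (fmap D z' x) = fmap D z' (fmap D z x)"
    if "x \<in> ar D" "z \<in> ar D" "z' \<in> ar D" for x z z'
    using f_f[OF that(1,3,2)] f_sym that brk_in(1) by metis
  have "fmap D z\<^sub>1 (F z\<^sub>2 x\<^sub>2 z\<^sub>3 x\<^sub>3) + fmap D z\<^sub>2 (F z\<^sub>3 x\<^sub>3 z\<^sub>1 x\<^sub>1) + fmap D z\<^sub>3 (F z\<^sub>1 x\<^sub>1 z\<^sub>2 x\<^sub>2) = 0"
    using x z brk_in(1) f3[of x\<^sub>1 z\<^sub>2 z\<^sub>3] f3[of x\<^sub>2 z\<^sub>1 z\<^sub>3] f3[of x\<^sub>3 z\<^sub>1 z\<^sub>2]
    by (simp add: F_def bilin_on_subspace(6)[OF f_bilin ar_subspace ar_subspace])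
  moreover have "(actJ D z\<^sub>1 (B z\<^sub>2 y\<^sub>2 x\<^sub>2 z\<^sub>3 y\<^sub>3 x\<^sub>3) + hmap D z\<^sub>1 (F z\<^sub>2 x\<^sub>2 z\<^sub>3 x\<^sub>3))
      + (actJ D z\<^sub>2 (B z\<^sub>3 y\<^sub>3 x\<^sub>3 z\<^sub>1 y\<^sub>1 x\<^sub>1) + hmap D z\<^sub>2 (F z\<^sub>3 x\<^sub>3 z\<^sub>1 x\<^sub>1))
      + (actJ D z\<^sub>3 (B z\<^sub>1 y\<^sub>1 x\<^sub>1 z\<^sub>2 y\<^sub>2 x\<^sub>2) + hmap D z\<^sub>3 (F z\<^sub>1 x\<^sub>1 z\<^sub>2 x\<^sub>2)) = 0" (is "?s = 0")
  proof (rule aJ_eqI)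
    fix i assume i: "i < dimJ D"
    have E: "alp D i u * hcomp D i v w - alp D i v * hcomp D i u w
          = hcomp D i v (fmap D u w) - hcomp D i u (fmap D v w)"
      "wedge12 (alp D i) (h2comp D i) u v w = 0"
      if "u \<in> ar D" "v \<in> ar D" "w \<in> ar D" for u v w
      using eqs i that unfolding gfh_equations_def by blast+
    \<comment> \<open>Defect of the first equation; the terms in the \<open>x\<close> form three
      cyclic instances of it.\<close>
    define e where "e u v w = alp D i u * hcomp D i v w - alp D i v * hcomp D i u w
      - (hcomp D i v (fmap D u w) - hcomp D i u (fmap D v w))" for u v w
    have cB: "coordJ D i (B z y x z' y' x') = alp D i z * coordJ D i y' - alp D i z' * coordJ D i y
        + hcomp D i z x' - hcomp D i z' x + 2 * \<i> * h2comp D i z z'"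
      if "z \<in> ar D" "x \<in> ar D" "z' \<in> ar D" "x' \<in> ar D" "y \<in> aJ D" "y' \<in> aJ D" for z x z' x' y y'
      using that i by (simp add: B_def cscale_eq_cmul coordJ_simps coordJ_actJ brk_in)
    have cF: "hcomp D i u (F z x z' x') = hcomp D i u (fmap D z x') - hcomp D i u (fmap D z' x)"
      if "z \<in> ar D" "x \<in> ar D" "z' \<in> ar D" "x' \<in> ar D" "u \<in> ar D" for u z x z' x'
      using that by (simp add: F_def bilin_on_subspace(6)[OF hmap_bilin ar_subspace ar_subspace]
          brk_in coordJ_diff)
    \<comment> \<open>Turns the cyclic sum of the Jacobi identity into the alternating sum of
      \<open>wedge12\<close>.\<close>
    have "h2comp D i z\<^sub>3 z\<^sub>1 = - h2comp D i z\<^sub>1 z\<^sub>3"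
      using halt_antisym[OF z(3,1)] brk_in(3)[OF z(1,3)] by (simp add: coordJ_minus)
    then have "coordJ D i ?s = e z\<^sub>1 z\<^sub>2 x\<^sub>3 + e z\<^sub>2 z\<^sub>3 x\<^sub>1 + e z\<^sub>3 z\<^sub>1 x\<^sub>2
        + 2 * \<i> * wedge12 (alp D i) (h2comp D i) z\<^sub>1 z\<^sub>2 z\<^sub>3"
      using i x y z
      by (simp add: coordJ_add coordJ_actJ B_in F_in brk_in cB cF wedge12_def e_def algebra_simps)
    also have "\<dots> = 0"
    proof -
      have "e u v w = 0" if "u \<in> ar D" "v \<in> ar D" "w \<in> ar D" for u v w
        unfolding e_def by (simp only: E(1)[OF that] diff_self)
      then show ?thesis using x z by (simp add: E(2)[OF z])
    qed
    finally have "coordJ D i ?s = 0" .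
    then show "coordJ D i ?s = coordJ D i 0" by (simp add: coordJ_zero[OF basis])
  qed (simp_all add: x z F_in brk_in)
  ultimately show ?thesis
    unfolding p using x y z by (simp add: nested zero_prod_def del: gfh_brk.simps)
qed

lemma aJ_fin_dim: "fin_dim_space (aJ D)"
proof -
  let ?B = "baseY D ` {..<dimJ D} \<union> mul_i D ` baseY D ` {..<dimJ D}"
  have "aJ D \<subseteq> span ?B"
  proof
    fix y assume "y \<in> aJ D"
    then have "y = (\<Sum>i<dimJ D. cmul (mul_i D) (coordJ D i y) (baseY D i))" by (rule aJ_expansion)
    also have "\<dots> \<in> span ?B"
      unfolding cmul_def by (intro span_sum span_add span_scale span_base) auto
    finally show "y \<in> span ?B" .
  qed
  moreover have "span ?B \<subseteq> aJ D" by (rule span_minimal) (auto simp: V_subspace)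
  ultimately show ?thesis unfolding fin_dim_space_def by (intro exI[of _ ?B]) auto
qed

lemma gfh_met_sym:
  assumes "p \<in> gfh_carr D" "q \<in> gfh_carr D"
  shows "gfh_met D p q = gfh_met D q p"
proof (cases p; cases q)
  fix y x z y' x' z' assume pq: "p = (y, x, z)" "q = (y', x', z')"
  then have "x \<in> ar D" "z \<in> ar D" "x' \<in> ar D" "z' \<in> ar D"
    using assms by (auto simp: gfh_carr_def)
  then show ?thesis
    using g0_sym[of x x'] g0_sym[of z z'] tau_antisym[of z x'] tau_antisym[of z' x]
    by (simp add: pq mult.commute)
qed

lemma gfh_met_bilin: "bilin_on (gfh_carr D) (gfh_carr D) UNIV (gfh_met D)"
proof -
  have lin: "lin_on (gfh_carr D) UNIV (gfh_met D p)" if p: "p \<in> gfh_carr D" for p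
  proof -
    obtain y x z where p': "p = (y, x, z)" "y \<in> aJ D" "x \<in> ar D" "z \<in> ar D"
      using p by (cases p) (auto simp: gfh_carr_def)
    have "gfh_met D p (q + r) = gfh_met D p q + gfh_met D p r"
      if "q \<in> gfh_carr D" "r \<in> gfh_carr D" for q r
      using that p' bilin_onD[OF g0_bilin] bilin_onD[OF tau_bilin]
      by (cases q; cases r) (simp add: gfh_carr_def coordJ_add algebra_simps sum.distrib)
    moreover have "gfh_met D p (t *\<^sub>R q) = t *\<^sub>R gfh_met D p q" if "q \<in> gfh_carr D" for q t
      using that p' bilin_onD[OF g0_bilin] bilin_onD[OF tau_bilin]
      by (cases q) (simp add: gfh_carr_def coordJ_scale algebra_simps sum_distrib_left)
    ultimately show ?thesis by (auto simp: lin_on_def)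
  qed
  have "lin_on (gfh_carr D) UNIV (\<lambda>p. gfh_met D p q)" if q: "q \<in> gfh_carr D" for q
  proof -
    have s: "gfh_met D p q = gfh_met D q p" if "p \<in> gfh_carr D" for p
      using gfh_met_sym[OF that q] .
    then show ?thesis
      using lin[OF q] gfh_carr_subspace
      unfolding lin_on_def by (simp add: subspace_add subspace_scale)
  qed
  then show ?thesis using lin by (auto simp: bilin_on_def)
qed

lemma gfh_acs_lin: "lin_on (gfh_carr D) (gfh_carr D) (gfh_acs D)"
  by (auto simp: lin_on_def gfh_carr_def J_simps)

lemma gfh_acs_acs: "p \<in> gfh_carr D \<Longrightarrow> gfh_acs D (gfh_acs D p) = - p"
  by (auto simp: gfh_carr_def J_simps)

lemma gfh_met_acs:
  assumes "p \<in> gfh_carr D" "q \<in> gfh_carr D"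
  shows "gfh_met D (gfh_acs D p) (gfh_acs D q) = gfh_met D p q"
  using assms bilin_on_subspace[OF g0_bilin ar_subspace ar_subspace]
    bilin_on_subspace[OF tau_bilin ar_subspace ar_subspace]
  by (cases p; cases q) (auto simp: gfh_carr_def coordJ_mul_i)

lemma gfh_almost_hermitian:
  assumes "gfh_equations D"
  shows "almost_hermitian (gfh D)"
proof -
  have "gfh_brk D p p = 0" if "p \<in> gfh_carr D" for p
  proof -
    have "gfh_brk D p p + gfh_brk D p p = 0"
      using gfh_brk_antisym[OF that that] by (simp only: eq_neg_iff_add_eq_0)
    then have "2 *\<^sub>R gfh_brk D p p = 0" by (simp only: scaleR_2)
    then show ?thesis by simp
  qed
  moreover have "fin_dim_space (gfh_carr D)"
    unfolding gfh_carr_def by (intro fin_dim_space_Times aJ_fin_dim ar_fin_dim)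
  ultimately have "lie_algebra_on (gfh_carr D) (gfh_brk D)"
    using gfh_brk_bilin gfh_jacobi[OF assms] by (simp add: lie_algebra_on_def)
  moreover have "inner_product_on (gfh_carr D) (gfh_met D)"
    using gfh_met_bilin gfh_met_sym met_pos by (simp add: inner_product_on_def symmetric_on_def)
  ultimately show ?thesis
    using gfh_acs_lin gfh_acs_acs gfh_met_acs by (simp add: almost_hermitian_def gfh_def)
qed

text \<open>For arguments in \<open>ar D\<close> the condition is
  \<open>[I X, I W] = I [I X, W] + I [X, I W]\<close>. Symmetry of \<open>f\<close> and
  \<open>hsym\<close> leaves twice \<open>mul_i\<close> of \<open>halt\<close> on the right, which
  explains the coefficient \<open>2 * \<i>\<close> in the bracket. Arguments in \<open>aJ D\<close>
  are covered by complex linearity of the action.\<close>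

lemma gfh_integrable: "integrable_acs (gfh D)"
  unfolding integrable_acs_def
proof (intro ballI)
  fix p q assume "p \<in> carr (gfh D)" "q \<in> carr (gfh D)"
  then obtain y x z y' x' z' where p: "p = (y, x, z)" "q = (y', x', z')"
    and y: "y \<in> aJ D" "y' \<in> aJ D" and x: "x \<in> ar D" "x' \<in> ar D" and z: "z \<in> ar D" "z' \<in> ar D"
    by (cases p; cases q) (auto simp: gfh_def gfh_carr_def)
  have h: "hmap D u v = hmap D v u + 2 *\<^sub>R halt D u v" if "u \<in> ar D" "v \<in> ar D" for u v
    using hsym_sym[OF that] halt_antisym[OF that(2,1)] by (simp add: hmap_def scaleR_2)
  have act_i: "actJ D u (mul_i D v) = mul_i D (actJ D u v)" if "v \<in> aJ D" for u v
    using that by (intro aJ_eqI) (auto simp: coordJ_actJ coordJ_mul_i)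
  have i2: "cscale D (2 * \<i>) v = 2 *\<^sub>R mul_i D v" for v by (simp add: cscale_def)
  note b = bilin_on_subspace[OF actJ_bilin ar_subspace V_subspace]
    bilin_on_subspace[OF hmap_bilin ar_subspace ar_subspace]
    bilin_on_subspace[OF halt_bilin ar_subspace ar_subspace]
    bilin_on_subspace[OF f_bilin ar_subspace ar_subspace]
  have "halt D z' x = - halt D x z'" "halt D z x' = - halt D x' z"
    using halt_antisym x z by blast+
  then show "brk (gfh D) (acs (gfh D) p) (acs (gfh D) q) - acs (gfh D) (brk (gfh D) (acs (gfh D) p) q)
      - acs (gfh D) (brk (gfh D) p (acs (gfh D) q)) - brk (gfh D) p q = 0"
    using x y z h[OF x] h[OF z] h[OF x(1) z(2)] h[OF x(2) z(1)]
      f_sym[OF x] f_sym[OF z] f_sym[OF x(1) z(2)] f_sym[OF x(2) z(1)] brk_in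
    by (simp add: p gfh_def act_i i2 b J_simps zero_prod_def)
qed

end

section \<open>Two-step solvable SKT Lie algebras\<close>

lemma ce_diff_3:
  "ce_diff b \<omega> [x, y, z] = - \<omega> [b x y, z] + \<omega> [b x z, y] - \<omega> [b y z, x]"
  by (simp add: ce_diff_def eval_nat_numeral lessThan_Suc nths_Cons)

lemma ce_diff_4:
  "ce_diff b \<omega> [x, y, z, w] = - \<omega> [b x y, z, w] + \<omega> [b x z, y, w] - \<omega> [b y z, x, w]
     - \<omega> [b x w, y, z] + \<omega> [b y w, x, z] - \<omega> [b z w, x, y]"
  by (simp add: ce_diff_def eval_nat_numeral lessThan_Suc nths_Cons)

locale two_step_skt =
  fixes L :: "'a::real_vector ah_struct"
  assumes skt: "skt L"
    and two_step: "two_step_solvable L"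
    and spanning: "{x + acs L y |x y. x \<in> derived_alg L \<and> y \<in> derived_alg L} = carr L"
begin

abbreviation "G \<equiv> carr L"
abbreviation "br \<equiv> brk L"
abbreviation "J \<equiv> acs L"
abbreviation "g \<equiv> met L"
abbreviation "\<aa> \<equiv> derived_alg L"

lemma hermitian: "almost_hermitian L" and integrable: "integrable_acs L"
  using skt by (auto simp: skt_def)

lemma br_bilin: "bilin_on G G G br"
  and br_self: "x \<in> G \<Longrightarrow> br x x = 0"
  and br_jacobi: "x \<in> G \<Longrightarrow> y \<in> G \<Longrightarrow> z \<in> G \<Longrightarrow>
    br x (br y z) + br y (br z x) + br z (br x y) = 0"
  using hermitian by (auto simp: almost_hermitian_def lie_algebra_on_def)

lemma hermitian_space_G: "hermitian_space G J g"
proof -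
  have "fin_dim_space G" "subspace G"
    using hermitian unfolding almost_hermitian_def lie_algebra_on_def fin_dim_space_def
    by (blast, metis subspace_span)
  then show ?thesis
    using hermitian by unfold_locales (auto simp: almost_hermitian_def)
qed

sublocale G: hermitian_space G J g
  by (rule hermitian_space_G)

lemmas br_zero = bilin_on_subspace(1,2)[OF br_bilin G.V_subspace G.V_subspace]
lemmas br_minus = bilin_on_subspace(3,4)[OF br_bilin G.V_subspace G.V_subspace]
lemmas br_in = bilin_onD(1)[OF br_bilin]
lemmas br_add = bilin_onD(2,3)[OF br_bilin]
lemmas br_scale = bilin_onD(4,5)[OF br_bilin]

lemma br_antisym:
  assumes "x \<in> G" "y \<in> G"
  shows "br x y = - br y x"
proof -
  have "br (x + y) (x + y) = br x x + br y x + (br x y + br y y)"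
    using assms by (simp only: br_add G.V_add)
  then show ?thesis using assms by (simp add: br_self eq_neg_iff_add_eq_0 add.commute)
qed

lemma a_subspace: "subspace \<aa>"
  by (simp add: derived_alg_def)

lemma br_in_a: "x \<in> G \<Longrightarrow> y \<in> G \<Longrightarrow> br x y \<in> \<aa>"
  unfolding derived_alg_def by (intro span_base) blast

lemma a_G: "x \<in> \<aa> \<Longrightarrow> x \<in> G"
proof -
  have "\<aa> \<subseteq> G"
    unfolding derived_alg_def by (rule span_minimal) (auto simp: br_in G.V_subspace)
  then show "x \<in> \<aa> \<Longrightarrow> x \<in> G" by blast
qed

lemma a_abelian: "x \<in> \<aa> \<Longrightarrow> y \<in> \<aa> \<Longrightarrow> br x y = 0"
  using two_step by (auto simp: two_step_solvable_def)

lemma a_closed: "x \<in> \<aa> \<Longrightarrow> y \<in> \<aa> \<Longrightarrow> x + y \<in> \<aa>" "x \<in> \<aa> \<Longrightarrow> y \<in> \<aa> \<Longrightarrow> x - y \<in> \<aa>"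
  "x \<in> \<aa> \<Longrightarrow> r *\<^sub>R x \<in> \<aa>" "x \<in> \<aa> \<Longrightarrow> - x \<in> \<aa>" "0 \<in> \<aa>"
  using a_subspace
  by (auto simp: subspace_add subspace_diff subspace_scale subspace_neg subspace_0)

text \<open>\<open>B\<close> is \<open>\<aa>\<^sub>J = \<gg>' \<inter> J \<gg>'\<close> and \<open>R\<close> is \<open>\<aa>\<^sub>r\<close>.\<close>

definition B :: "'a set" where
  "B = {x \<in> \<aa>. J x \<in> \<aa>}"

definition R :: "'a set" where
  "R = {x \<in> \<aa>. \<forall>y\<in>B. g x y = 0}"

lemma B_a: "x \<in> B \<Longrightarrow> x \<in> \<aa>" "x \<in> B \<Longrightarrow> J x \<in> \<aa>" and B_G: "x \<in> B \<Longrightarrow> x \<in> G"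
  and R_a: "x \<in> R \<Longrightarrow> x \<in> \<aa>" and R_G: "x \<in> R \<Longrightarrow> x \<in> G"
  by (auto simp: B_def R_def a_G)

lemma R_B: "x \<in> R \<Longrightarrow> y \<in> B \<Longrightarrow> g x y = 0"
  by (simp add: R_def)

lemma B_subspace: "subspace B"
  by (auto simp: subspace_def B_def a_closed G.J_simps a_G)

lemma B_J: "x \<in> B \<Longrightarrow> J x \<in> B"
  by (simp add: B_def G.J_simps a_closed a_G)

lemma R_subspace: "subspace R"
  by (auto simp: subspace_def R_def a_closed G.g_zero G.g_add G.g_scale a_G B_G)

sublocale B: hermitian_space B J g
proof -
  have "complex_space B J"
    by (rule complex_space_subset[OF G.complex_space_axioms B_subspace]) (auto simp: B_G B_J)
  moreover have "fin_dim_space B"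
    by (rule fin_dim_space_subspace[OF B_subspace _ G.fin_dim]) (auto simp: B_G)
  moreover have "inner_product_on B g"
    using G.inner B_G unfolding inner_product_on_def symmetric_on_def bilin_on_def lin_on_def by simp
  ultimately show "hermitian_space B J g"
    by (simp add: hermitian_space_def hermitian_space_axioms_def G.g_J B_G)
qed

section \<open>Consequences of integrability for the maps \<open>[J x, \<cdot>]\<close>\<close>

lemma nijenhuis: "x \<in> G \<Longrightarrow> y \<in> G \<Longrightarrow> br (J x) (J y) = J (br (J x) y) + J (br x (J y)) + br x y"
  using integrable by (simp add: integrable_acs_def algebra_simps)

text \<open>Since \<open>x\<close>, \<open>y\<close> and \<open>J y\<close> lie in the abelian
  derived algebra, two terms of the Nijenhuis condition vanish.\<close>

lemma ad_J:
  assumes "x \<in> \<aa>" "y \<in> B"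
  shows "br (J x) (J y) = J (br (J x) y)"
  using nijenhuis[of x y] assms by (simp add: a_G B_G a_abelian B_a G.J_zero)

lemma ad_B: "x \<in> \<aa> \<Longrightarrow> y \<in> B \<Longrightarrow> br (J x) y \<in> B"
  using ad_J[of x y] br_in_a[of "J x"] by (simp add: B_def a_G)
    (metis G.J_in a_G br_in_a)

lemma ad_clin: "x \<in> \<aa> \<Longrightarrow> clin_on B J (br (J x))"
  by (simp add: clin_on_def lin_on_def ad_B ad_J br_add br_scale a_G B_G)

lemma ad_sym: "x \<in> \<aa> \<Longrightarrow> y \<in> \<aa> \<Longrightarrow> br (J x) (J y) = J (br (J x) y - br (J y) x)"
  using nijenhuis[of x y] br_antisym[of "J y" x] by (simp add: a_G a_abelian G.J_simps br_in)

text \<open>By \<open>ad_sym\<close>, \<open>J\<close> maps this difference to a bracket, hence back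
  into the derived algebra.\<close>

lemma ad_diff_B: "x \<in> \<aa> \<Longrightarrow> y \<in> \<aa> \<Longrightarrow> br (J x) y - br (J y) x \<in> B"
  using ad_sym[of x y] br_in_a[of "J x" "J y"] by (simp add: B_def a_G br_in_a a_closed)

text \<open>In the Jacobi identity \<open>[z, [J x, J y]]\<close> vanishes, both entries lying in
  \<open>\<aa>\<close>. Its part on \<open>B\<close> feeds the diagonalization; on \<open>R\<close>
  it yields the total symmetry of \<open>f (f X Y) Z\<close> and the first equation.\<close>

lemma ad_commute:
  assumes "x \<in> \<aa>" "y \<in> \<aa>" "z \<in> \<aa>"
  shows "br (J x) (br (J y) z) = br (J y) (br (J x) z)"
proof -
  have "br z (br (J x) (J y)) = 0" using assms by (simp add: a_abelian br_in_a a_G)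
  moreover have "br (J y) (br z (J x)) = - br (J y) (br (J x) z)"
    using assms br_antisym[of z "J x"] by (simp add: a_G br_minus br_in)
  ultimately show ?thesis using br_jacobi[of "J x" "J y" z] assms by (simp add: a_G)
qed

section \<open>The SKT condition as an operator identity on \<open>B\<close>\<close>

text \<open>On \<open>G\<close> this is the pullback by \<open>J\<close> of the differential of the
  fundamental form, with the outer \<open>J\<close> removed by orthogonality; up to sign it is the
  torsion form of the Bismut connection.\<close>

definition torsion :: "'a \<Rightarrow> 'a \<Rightarrow> 'a \<Rightarrow> real" where
  "torsion x y z = - g (br (J x) (J y)) z + g (br (J x) (J z)) y - g (br (J y) (J z)) x"

lemma torsion_closed:
  assumes "x \<in> G" "y \<in> G" "z \<in> G" "w \<in> G"
  shows "- torsion (br x y) z w + torsion (br x z) y w - torsion (br y z) x w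
     - torsion (br x w) y z + torsion (br y w) x z - torsion (br z w) x y = 0"
proof -
  have t: "acs_pull J (ce_diff br (fund_form L)) [x, y, z] = torsion x y z"
    if "x \<in> G" "y \<in> G" "z \<in> G" for x y z
    using that by (simp add: acs_pull_def ce_diff_3 fund_form_def G.g_J br_in torsion_def)
  have "ce_diff br (acs_pull J (ce_diff br (fund_form L))) [x, y, z, w] = 0"
    using skt assms by (simp add: skt_def)
  then show ?thesis using assms by (simp add: ce_diff_4 t br_in)
qed

lemma torsion_zero: "y \<in> G \<Longrightarrow> z \<in> G \<Longrightarrow> torsion 0 y z = 0"
  by (simp add: torsion_def G.J_zero br_zero G.g_zero G.g_zero_right br_in)

text \<open>Closedness at \<open>x\<close>, \<open>J x\<close>, \<open>y\<close>, \<open>z\<close>.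
  Three of the six brackets vanish as \<open>x\<close>, \<open>y\<close>, \<open>z\<close> lie in
  the abelian \<open>\<aa>\<close>; the terms quadratic in \<open>A x\<close> come from
  \<open>[J x, y]\<close> and \<open>[J x, z]\<close>, which stay in \<open>B\<close>.\<close>

lemma skt_identity_J:
  assumes x: "x \<in> \<aa>" and y: "y \<in> B" and z: "z \<in> B"
  defines "A \<equiv> \<lambda>x. br (J x)"
  shows "- g (A (A x x) (J y)) z + g (A (A x x) (J z)) y - g (A x (J (A x y))) z
    + g (A x (J z)) (A x y) + g (A x (J (A x z))) y - g (A x (J y)) (A x z) = 0"
proof -
  note mem = x y z a_G[OF x] B_G[OF y] B_G[OF z] B_a(1)[OF y] B_a(1)[OF z] B_a(2)[OF y] B_a(2)[OF z]
  have Axx: "A x x \<in> \<aa>" using x by (simp add: A_def br_in_a a_G)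
  have v: "br x (J x) = - A x x" using x br_antisym[of x "J x"] by (simp add: A_def a_G)
  have t1: "torsion (- A x x) y z = g (A (A x x) (J y)) z - g (A (A x x) (J z)) y"
    using mem Axx a_G[OF Axx]
    by (simp add: torsion_def a_abelian G.g_zero A_def G.J_minus br_minus br_in G.g_minus)
  have t2: "torsion (A x u) x w = g (A x (J (A x u))) w - g (A x (J w)) (A x u)"
    if u: "u \<in> B" and w: "w \<in> B" for u w
  proof -
    have "br (J (A x u)) (J w) = 0"
      using ad_B[OF x u] w by (intro a_abelian) (auto simp: A_def B_a)
    moreover have "br (J (A x u)) (J x) = - A x (J (A x u))"
      using ad_B[OF x u] x br_antisym[of "J (A x u)" "J x"] by (simp add: A_def B_G a_G)
    ultimately show ?thesis
      using ad_B[OF x u] x w B_J[OF ad_B[OF x u]]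
      by (simp add: torsion_def G.g_zero a_G B_G G.g_minus br_in A_def)
  qed
  have "- torsion (br x (J x)) y z + torsion (br x y) (J x) z - torsion (br (J x) y) x z
     - torsion (br x z) (J x) y + torsion (br (J x) z) x y - torsion (br y z) x (J x) = 0"
    by (rule torsion_closed) (use mem in auto)
  then have "- torsion (- A x x) y z - torsion (A x y) x z + torsion (A x z) x y = 0"
    using mem by (simp add: v a_abelian torsion_zero A_def)
  then show ?thesis by (simp add: t1 t2 y z)
qed

text \<open>The previous identity at \<open>J y\<close>, \<open>z\<close>: complex linearity moves
  each \<open>J\<close> outwards, where pairs of them cancel up to sign.\<close>

lemma skt_identity_real:
  assumes x: "x \<in> \<aa>" and y: "y \<in> B" and z: "z \<in> B"
  defines "A \<equiv> \<lambda>x. br (J x)"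
  shows "g (A (A x x) y) z + g y (A (A x x) z) + g (A x (A x y)) z + g y (A x (A x z))
    + 2 * g (A x y) (A x z) = 0"
proof -
  have Axx: "br (J x) x \<in> \<aa>" using x by (simp add: br_in_a a_G)
  have J: "br (J u) (J w) = J (br (J u) w)" if "u \<in> \<aa>" "w \<in> B" for u w
    using that by (rule ad_J)
  note mem = Axx x y z ad_B[OF x y] ad_B[OF x z] ad_B[OF Axx y] ad_B[OF Axx z]
    ad_B[OF x ad_B[OF x y]] ad_B[OF x ad_B[OF x z]]
  show ?thesis
    using skt_identity_J[OF x B_J[OF y] z] mem G.g_sym[of y] G.g_sym[of "br (J x) z" "br (J x) y"]
    by (simp add: A_def J B.J_simps br_minus B_G a_G G.g_minus G.g_J)
qed

text \<open>The real part is the preceding identity at \<open>y\<close>, \<open>z\<close>, the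
  imaginary part the same identity at \<open>y\<close>, \<open>J z\<close>.\<close>

lemma skt_identity:
  assumes x: "x \<in> \<aa>" and y: "y \<in> B" and z: "z \<in> B"
  defines "A \<equiv> \<lambda>x. br (J x)"
  shows "B.H (A (A x x) y) z + B.H y (A (A x x) z) + B.H (A x (A x y)) z + B.H y (A x (A x z))
    + 2 * B.H (A x y) (A x z) = 0"
proof -
  have Axx: "br (J x) x \<in> \<aa>" using x by (simp add: br_in_a a_G)
  have J: "br (J u) (J w) = J (br (J u) w)" if "u \<in> \<aa>" "w \<in> B" for u w
    using that by (rule ad_J)
  show ?thesis
    using skt_identity_real[OF x y z] skt_identity_real[OF x y B_J[OF z]] Axx
    by (simp add: A_def complex_eq_iff herm_def J x z ad_B)
qed

end

text \<open>The explicit map runs from the model to \<open>L\<close>, opposite to the definition of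
  isomorphism. Closure of \<open>carr M\<close> under bracket and complex structure lets the inverse
  be applied to their images.\<close>

lemma ah_isomorphicI:
  assumes S: "subspace (carr M)"
    and bij: "bij_betw \<psi> (carr M) (carr L)" and lin: "lin_on (carr M) (carr L) \<psi>"
    and brk: "\<And>p q. p \<in> carr M \<Longrightarrow> q \<in> carr M \<Longrightarrow> brk M p q \<in> carr M \<and> \<psi> (brk M p q) = brk L (\<psi> p) (\<psi> q)"
    and met: "\<And>p q. p \<in> carr M \<Longrightarrow> q \<in> carr M \<Longrightarrow> met L (\<psi> p) (\<psi> q) = met M p q"
    and acs: "\<And>p. p \<in> carr M \<Longrightarrow> acs M p \<in> carr M \<and> \<psi> (acs M p) = acs L (\<psi> p)"
  shows "ah_isomorphic L M"
proof -
  define \<phi> where "\<phi> = inv_into (carr M) \<psi>"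
  have \<phi>\<psi>: "\<phi> (\<psi> p) = p" if "p \<in> carr M" for p
    using bij that by (simp add: \<phi>_def bij_betw_def)
  have im: "\<exists>p\<in>carr M. x = \<psi> p" if "x \<in> carr L" for x
    using bij that by (auto simp: bij_betw_def)
  have b: "bij_betw \<phi> (carr L) (carr M)"
    unfolding \<phi>_def by (rule bij_betw_inv_into[OF bij])
  have "\<phi> (x + y) = \<phi> x + \<phi> y" if xy: "x \<in> carr L" "y \<in> carr L" for x y
  proof -
    obtain p q where "p \<in> carr M" "q \<in> carr M" "x = \<psi> p" "y = \<psi> q" using im xy by blast
    then show ?thesis using lin \<phi>\<psi>[of "p + q"] S by (simp add: lin_on_def \<phi>\<psi> subspace_add)
  qed
  moreover have "\<phi> (c *\<^sub>R x) = c *\<^sub>R \<phi> x" if xy: "x \<in> carr L" for x c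
  proof -
    obtain p where "p \<in> carr M" "x = \<psi> p" using im xy by blast
    then show ?thesis using lin \<phi>\<psi>[of "c *\<^sub>R p"] S by (simp add: lin_on_def \<phi>\<psi> subspace_scale)
  qed
  ultimately have l: "lin_on (carr L) (carr M) \<phi>"
    using b by (auto simp: lin_on_def bij_betw_def)
  have 1: "\<phi> (brk L x y) = brk M (\<phi> x) (\<phi> y)" "met M (\<phi> x) (\<phi> y) = met L x y"
    if xy: "x \<in> carr L" "y \<in> carr L" for x y
  proof -
    obtain p q where pq: "p \<in> carr M" "q \<in> carr M" "x = \<psi> p" "y = \<psi> q" using im xy by blast
    show "\<phi> (brk L x y) = brk M (\<phi> x) (\<phi> y)"
      using brk[OF pq(1,2)] \<phi>\<psi>[of "brk M p q"] by (simp add: pq \<phi>\<psi>)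
    show "met M (\<phi> x) (\<phi> y) = met L x y"
      using met[OF pq(1,2)] by (simp add: pq \<phi>\<psi>)
  qed
  have 2: "\<phi> (acs L x) = acs M (\<phi> x)" if xy: "x \<in> carr L" for x
  proof -
    obtain p where p: "p \<in> carr M" "x = \<psi> p" using im xy by blast
    show ?thesis using acs[OF p(1)] \<phi>\<psi>[of "acs M p"] by (simp add: p \<phi>\<psi>)
  qed
  show ?thesis unfolding ah_isomorphic_def using b l 1 2 by blast
qed

section \<open>The data \<open>(f, h, \<alpha>)\<close> read off from a diagonalizing unitary
  basis\<close>

locale diagonalized_skt = two_step_skt L for L :: "'a::real_vector ah_struct" +
  fixes m :: nat and e :: "nat \<Rightarrow> 'a" and a :: "nat \<Rightarrow> 'a \<Rightarrow> complex"
  assumes e_orthonormal: "B.orthonormal m e"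
    and e_eigen: "x \<in> \<aa> \<Longrightarrow> i < m \<Longrightarrow> br (J x) (e i) = cmul J (a i x) (e i)"
    and e_complete: "y \<in> B \<Longrightarrow> B.proj m e y = y"
begin

text \<open>Used on all of \<open>G\<close>, where it is the orthogonal projection onto
  \<open>B\<close>.\<close>

definition P :: "'a \<Rightarrow> 'a" where
  "P x = B.proj m e x"

definition hh :: "'a \<Rightarrow> 'a \<Rightarrow> 'a" where
  "hh x w = P (br (J x) w)"

definition ff :: "'a \<Rightarrow> 'a \<Rightarrow> 'a" where
  "ff x w = br (J x) w - P (br (J x) w)"

text \<open>\<open>hsym\<close> and \<open>halt\<close> are the symmetric and antisymmetric parts of
  \<open>hh\<close>. The eigenvalue is written as a Hermitian product because that expression is
  visibly linear in \<open>x\<close>, whereas \<open>a\<close> is merely some choice of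
  eigenvalues.\<close>

definition D :: "('a, 'a) gfh_data" where
  "D = \<lparr>aJ = B, mul_i = J, dimJ = m, baseY = e, ar = R, fmap = ff,
     hsym = (\<lambda>x w. (1 / 2) *\<^sub>R (hh x w + hh w x)),
     halt = (\<lambda>x w. (1 / 2) *\<^sub>R (hh x w - hh w x)),
     alp = (\<lambda>i x. B.H (br (J x) (e i)) (e i)),
     gzero = g, tauzero = (\<lambda>x w. g (J x) w)\<rparr>"

lemma D_simps: "aJ D = B" "mul_i D = J" "dimJ D = m" "baseY D = e" "ar D = R" "fmap D = ff"
  "halt D x w = (1 / 2) *\<^sub>R (hh x w - hh w x)" "alp D i x = B.H (br (J x) (e i)) (e i)"
  "gzero D = g" "tauzero D x w = g (J x) w"
  and hmap_D: "hmap D x w = hh x w"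
  by (simp_all add: D_def hmap_def scaleR_add_right[symmetric] del: scaleR_add_right)

lemma e_in: "i < m \<Longrightarrow> e i \<in> B"
  and e_self: "i < m \<Longrightarrow> B.H (e i) (e i) = 1"
  using e_orthonormal by (auto simp: B.orthonormal_def)

lemma G_orthonormal: "G.orthonormal m e"
  using e_orthonormal by (simp add: B.orthonormal_def G.orthonormal_def B_G)

lemma P_clin: "clin_on G J P"
  using G.proj_clin[OF G_orthonormal] by (simp add: P_def[abs_def])

lemmas P_simps = G.clin_onD(3,4)[OF P_clin] lin_on_diff[OF G.V_subspace G.clin_onD(1)[OF P_clin]]

lemma P_scale: "x \<in> G \<Longrightarrow> P (r *\<^sub>R x) = r *\<^sub>R P x"
  using G.clin_onD(1)[OF P_clin] by (simp add: lin_on_def)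

lemma P_in: "P x \<in> B"
  by (auto simp: P_def B.proj_def e_in)

lemma P_B: "y \<in> B \<Longrightarrow> P y = y"
  using e_complete by (simp add: P_def)

lemma H_P: "x \<in> G \<Longrightarrow> i < m \<Longrightarrow> B.H (P x) (e i) = B.H x (e i)"
  using G.H_proj[OF G_orthonormal] by (simp add: P_def)

lemma B_expansion: "y \<in> B \<Longrightarrow> y = (\<Sum>i<m. cmul J (B.H y (e i)) (e i))"
  using e_complete by (simp add: B.proj_def)

text \<open>Here \<open>x\<close> may lie outside \<open>B\<close>, so that orthogonality to the
  \<open>e i\<close> yields orthogonality to \<open>B\<close> in \<open>minus_P_R\<close>.\<close>

lemma H_parseval:
  assumes "x \<in> G" "y \<in> B"
  shows "B.H y x = (\<Sum>i<m. B.H y (e i) * cnj (B.H x (e i)))"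
proof -
  have "B.H y x = B.H (\<Sum>i<m. cmul J (B.H y (e i)) (e i)) x"
    using B_expansion[OF assms(2)] by simp
  also have "\<dots> = (\<Sum>i<m. B.H y (e i) * B.H (e i) x)"
    using assms(1) by (subst G.H_sum) (auto simp: G.H_cmul B_G e_in)
  also have "\<dots> = (\<Sum>i<m. B.H y (e i) * cnj (B.H x (e i)))"
    using assms(1) by (intro sum.cong) (auto simp: G.H_cnj[of x] B_G e_in)
  finally show ?thesis .
qed

lemma minus_P_R:
  assumes "x \<in> \<aa>"
  shows "x - P x \<in> R"
proof -
  have x: "x \<in> G" "P x \<in> G" using assms P_in by (auto simp: a_G B_G)
  have "g (x - P x) y = 0" if y: "y \<in> B" for y
  proof -
    have "B.H y (x - P x) = (\<Sum>i<m. B.H y (e i) * cnj (B.H (x - P x) (e i)))"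
      using x y by (intro H_parseval) auto
    also have "\<dots> = 0" using x H_P[OF x(1)] by (simp add: G.H_diff B_G e_in)
    finally have "g y (x - P x) = 0" by (simp add: herm_def complex_eq_iff)
    then show ?thesis using x y G.g_sym[of y] by (simp add: B_G)
  qed
  then show ?thesis using assms P_in by (simp add: R_def a_closed B_a)
qed

lemma P_R: "x \<in> R \<Longrightarrow> P x = 0"
  using R_B[of x] by (auto simp: P_def B.proj_def herm_def complex_eq_iff e_in B_J
      intro!: sum.neutral) (simp add: cmul_def)

lemma R_closed: "x \<in> R \<Longrightarrow> y \<in> R \<Longrightarrow> x + y \<in> R" "x \<in> R \<Longrightarrow> y \<in> R \<Longrightarrow> x - y \<in> R"
  "x \<in> R \<Longrightarrow> r *\<^sub>R x \<in> R" "x \<in> R \<Longrightarrow> - x \<in> R" "0 \<in> R"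
  using R_subspace
  by (auto simp: subspace_add subspace_diff subspace_scale subspace_neg subspace_0)

lemma B_R_zero:
  assumes "y \<in> B" "y \<in> R"
  shows "y = 0"
  using R_B[OF assms(2,1)] G.g_pos[OF B_G[OF assms(1)]] by force

lemma ad_in: "x \<in> \<aa> \<Longrightarrow> w \<in> G \<Longrightarrow> br (J x) w \<in> \<aa>"
  by (simp add: br_in_a a_G)

lemma hh_in: "hh x w \<in> B"
  by (simp add: hh_def P_in)

lemma ff_in: "x \<in> R \<Longrightarrow> w \<in> R \<Longrightarrow> ff x w \<in> R"
  unfolding ff_def by (intro minus_P_R ad_in R_a R_G)

lemma hh_ff: "br (J x) w = hh x w + ff x w"
  by (simp add: hh_def ff_def)

lemma ad_bilin: "bilin_on R R \<aa> (\<lambda>x w. br (J x) w)"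
  by (simp add: bilin_on_def lin_on_def ad_in R_a R_G br_add br_scale G.J_simps)

lemma hh_bilin: "bilin_on R R B hh"
  using bilin_onD[OF ad_bilin]
  by (simp add: bilin_on_def lin_on_def hh_def P_in P_simps P_scale a_G)

lemma ff_bilin: "bilin_on R R R ff"
  using bilin_onD[OF ad_bilin]
  by (simp add: bilin_on_def lin_on_def ff_in)
    (simp add: ff_def P_simps P_scale a_G scaleR_diff_right)

text \<open>The antisymmetric part of \<open>[J x, w]\<close> lies in \<open>B\<close> by
  \<open>ad_diff_B\<close>, and subtracting \<open>P\<close> removes it.\<close>

lemma ff_sym: "x \<in> R \<Longrightarrow> w \<in> R \<Longrightarrow> ff x w = ff w x"
  using P_B[OF ad_diff_B[of x w]] by (simp add: ff_def P_simps R_a R_G ad_in a_G algebra_simps)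

lemma ad_eigen:
  assumes "x \<in> \<aa>" "y \<in> B" "i < m"
  shows "B.H (br (J x) y) (e i) = B.H (br (J x) (e i)) (e i) * B.H y (e i)"
proof -
  note T = B.clin_onD[OF ad_clin[OF assms(1)]]
  have "br (J x) y = br (J x) (\<Sum>j<m. cmul J (B.H y (e j)) (e j))"
    using B_expansion[OF assms(2)] by simp
  also have "\<dots> = (\<Sum>j<m. cmul J (B.H y (e j) * a j x) (e j))"
    by (subst lin_on_sum[OF T(1) B_subspace])
      (auto simp: e_in T(5) e_eigen assms(1) B.cmul_cmul)
  finally have "B.H (br (J x) y) (e i) = B.H (\<Sum>j<m. cmul J (B.H y (e j) * a j x) (e j)) (e i)"
    by simp
  also have "\<dots> = (\<Sum>j<m. B.H y (e j) * a j x * B.H (e j) (e i))"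
    using assms(3) by (subst B.H_sum) (auto simp: B.H_cmul e_in)
  also have "\<dots> = (\<Sum>j<m. if j = i then B.H y (e j) * a j x else 0)"
    using e_orthonormal assms(3) by (intro sum.cong) (auto simp: B.orthonormal_def)
  finally show ?thesis using assms by (simp add: e_eigen B.H_cmul e_in e_self)
qed

text \<open>The first two summands lie in \<open>B\<close>, the last in \<open>R\<close>. Since the
  left side is symmetric in \<open>x\<close> and \<open>w\<close>, the \<open>R\<close> part gives
  \<open>ff_ff\<close> and the \<open>B\<close> part the first equation.\<close>

lemma ad_ad:
  assumes "x \<in> R" "w \<in> R" "z \<in> R"
  shows "br (J x) (br (J w) z) = br (J x) (hh w z) + (hh x (ff w z) + ff x (ff w z))"
proof -
  have "ff w z \<in> R" using ff_in assms by simp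
  then show ?thesis
    using assms hh_in[of w z] by (simp add: hh_ff[of w z] br_add R_G B_G hh_ff[of x "ff w z"])
qed

lemma ff_ff:
  assumes "x \<in> R" "w \<in> R" "z \<in> R"
  shows "ff x (ff w z) = ff w (ff x z)"
proof -
  have P: "br (J x) (br (J w) z) - P (br (J x) (br (J w) z)) = ff x (ff w z)"
    if "x \<in> R" "w \<in> R" "z \<in> R" for x w z
  proof -
    have F: "ff x (ff w z) \<in> R" using ff_in that by simp
    have A: "br (J x) (hh w z) \<in> B" using ad_B hh_in that R_a by blast
    show ?thesis
      using A F hh_in P_R[OF F] by (simp add: ad_ad[OF that] P_simps P_B B_G R_G)
  qed
  show ?thesis
    using P[OF assms] P[OF assms(2,1,3)] ad_commute[of x w z] assms by (simp add: R_a)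
qed

lemma cexpansion_D:
  assumes "y \<in> B"
  shows "cexpansion D y c \<longleftrightarrow> c = (\<lambda>i. if i < m then B.H y (e i) else 0)"
proof
  assume "cexpansion D y c"
  then have c: "\<forall>i\<ge>m. c i = 0" "y = (\<Sum>i<m. cmul J (c i) (e i))"
    by (auto simp: cexpansion_def D_simps cscale_eq_cmul)
  have "B.H y (e j) = c j" if j: "j < m" for j
  proof -
    have "B.H y (e j) = (\<Sum>i<m. c i * B.H (e i) (e j))"
      unfolding c(2) using j by (subst B.H_sum) (auto simp: B.H_cmul e_in)
    also have "\<dots> = (\<Sum>i<m. if i = j then c i else 0)"
      using e_orthonormal j by (intro sum.cong) (auto simp: B.orthonormal_def)
    finally show ?thesis using j by simp
  qed
  then show "c = (\<lambda>i. if i < m then B.H y (e i) else 0)" using c(1) by auto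
next
  assume "c = (\<lambda>i. if i < m then B.H y (e i) else 0)"
  then show "cexpansion D y c"
    using B_expansion[OF assms] by (simp add: cexpansion_def D_simps cscale_eq_cmul)
qed

lemma basis_D: "complex_space_basis D"
proof -
  have "\<exists>!c. cexpansion D y c" if "y \<in> B" for y
    using cexpansion_D[OF that] by simp
  then show ?thesis
    using B_subspace B.J_lin by (simp add: complex_space_basis_def) (simp add: D_simps B.J_J e_in)
qed

lemma coordJ_D: "y \<in> B \<Longrightarrow> i < m \<Longrightarrow> coordJ D i y = B.H y (e i)"
  using coordJ_eqI[OF basis_D, of y "\<lambda>i. if i < m then B.H y (e i) else 0" i] cexpansion_D[of y]
  by (simp add: D_simps)

section \<open>The comparison map from the model to \<open>L\<close>\<close>

fun \<psi> :: "'a \<times> 'a \<times> 'a \<Rightarrow> 'a" where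
  "\<psi> (y, x, z) = y + x + J z"

lemma carr_D: "p \<in> gfh_carr D \<longleftrightarrow> fst p \<in> B \<and> fst (snd p) \<in> R \<and> snd (snd p) \<in> R"
  by (cases p) (auto simp: gfh_carr_def D_simps)

lemma \<psi>_lin: "lin_on (gfh_carr D) G \<psi>"
  by (auto simp: lin_on_def carr_D B_G R_G G.J_simps scaleR_add_right)

text \<open>The sum of \<open>B\<close>, \<open>R\<close> and \<open>J R\<close> is direct:
  \<open>J z = - (y + x)\<close> puts \<open>z\<close> into \<open>B\<close>, which meets
  \<open>R\<close> only in zero, and then \<open>x = - y\<close> does the same for
  \<open>x\<close>.\<close>

lemma \<psi>_zero:
  assumes "p \<in> gfh_carr D" "\<psi> p = 0"
  shows "p = 0"
proof -
  obtain y x z where p: "p = (y, x, z)" "y \<in> B" "x \<in> R" "z \<in> R"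
    using assms(1) by (cases p) (auto simp: carr_D)
  have s: "y + x + J z = 0" using assms(2) by (simp add: p)
  then have "J z = - (y + x)" by (simp only: add_eq_0_iff)
  then have "J z \<in> \<aa>" using p B_a R_a by (simp add: a_closed)
  then have "z \<in> B" using p by (simp add: B_def R_a)
  then have z: "z = 0" using p B_R_zero by blast
  then have "x = - y" using s G.J_zero by (simp add: add_eq_0_iff)
  then have "x \<in> B" using p by simp
  then have "x = 0" using p B_R_zero by blast
  then show ?thesis using s z G.J_zero by (simp add: p zero_prod_def)
qed

lemma carr_D_subspace: "subspace (gfh_carr D)"
  by (auto simp: subspace_def carr_D R_closed)

lemma \<psi>_bij: "bij_betw \<psi> (gfh_carr D) G"
  unfolding bij_betw_def
proof
  show "inj_on \<psi> (gfh_carr D)"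
  proof (rule inj_onI)
    fix p q assume "p \<in> gfh_carr D" "q \<in> gfh_carr D" "\<psi> p = \<psi> q"
    then show "p = q"
      using \<psi>_zero[of "p - q"] lin_on_diff[OF carr_D_subspace \<psi>_lin, of p q]
        subspace_diff[OF carr_D_subspace, of p q] by simp
  qed
  show "\<psi> ` gfh_carr D = G"
  proof
    show "\<psi> ` gfh_carr D \<subseteq> G" using \<psi>_lin by (auto simp: lin_on_def)
    show "G \<subseteq> \<psi> ` gfh_carr D"
    proof
      fix w assume "w \<in> G"
      then obtain u v where uv: "u \<in> \<aa>" "v \<in> \<aa>" "w = u + J v" using spanning by blast
      \<comment> \<open>Both \<open>u\<close> and \<open>v\<close> are split by \<open>P\<close>;
        the part \<open>J (P v)\<close> goes to the first component because \<open>B\<close> is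
        \<open>J\<close>-invariant.\<close>
      let ?p = "(P u + J (P v), u - P u, v - P v)"
      have "\<psi> ?p = w"
        using uv a_G B_G[OF P_in] by (simp add: G.J_simps)
      moreover have "?p \<in> gfh_carr D"
        using uv P_in by (simp add: carr_D minus_P_R B_J)
      ultimately show "w \<in> \<psi> ` gfh_carr D" by (intro image_eqI[where x = ?p]) simp_all
    qed
  qed
qed

lemma \<psi>_met:
  assumes "p \<in> gfh_carr D" "q \<in> gfh_carr D"
  shows "g (\<psi> p) (\<psi> q) = gfh_met D p q"
proof -
  obtain y x z y' x' z' where p: "p = (y, x, z)" "q = (y', x', z')"
    and y: "y \<in> B" "y' \<in> B" and x: "x \<in> R" "x' \<in> R" and z: "z \<in> R" "z' \<in> R"
    using assms by (cases p; cases q) (auto simp: carr_D)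
  have "g y y' = (\<Sum>i<m. Re (coordJ D i y * cnj (coordJ D i y')))"
    using H_parseval[OF B_G[OF y(2)] y(1)] y by (simp add: herm_def complex_eq_iff coordJ_D)
  moreover have "g y u = 0" "g y (J u) = 0" "g u y = 0" "g (J u) y = 0" if "y \<in> B" "u \<in> R" for y u
  proof -
    show 1: "g u y = 0" using R_B that by blast
    show 2: "g (J u) y = 0" using R_B[OF that(2) B_J[OF that(1)]] that by (simp add: G.g_J_left B_G R_G)
    show "g y u = 0" "g y (J u) = 0" using 1 2 that G.g_sym[of y] by (simp_all add: B_G R_G)
  qed
  ultimately show ?thesis
    using x y z
    by (simp add: p D_simps G.g_add G.g_add_right B_G R_G G.g_J_left G.J_J G.g_minus_right)
qed

lemma valid_D: "gfh_valid D"
proof -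
  have sym: "symmetric_on R g" using G.inner R_G by (simp add: inner_product_on_def symmetric_on_def)
  have bil: "bilin_on R R UNIV g" "bilin_on R R UNIV (\<lambda>x w. g (J x) w)"
    by (simp_all add: bilin_on_def lin_on_def R_G G.g_add G.g_add_right G.g_scale G.g_scale_right G.J_simps)
  have anti: "antisymmetric_on R (\<lambda>x w. g (J x) w)"
    using G.g_J_left G.g_sym R_G unfolding antisymmetric_on_def by (metis G.J_in)
  have alp: "lin_on R UNIV (\<lambda>x. B.H (br (J x) (e i)) (e i))" if "i < m" for i
    using that by (simp add: lin_on_def R_G B_G e_in G.J_simps br_add br_scale G.H_add G.H_scale br_in
        scaleR_conv_of_real)
  have h: "bilin_on R R B (\<lambda>x w. (1 / 2) *\<^sub>R (hh x w + hh w x))"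
    "bilin_on R R B (\<lambda>x w. (1 / 2) *\<^sub>R (hh x w - hh w x))"
    using bilin_onD[OF hh_bilin] by (simp_all add: bilin_on_def lin_on_def algebra_simps)
  have hs: "symmetric_on R (\<lambda>x w. (1 / 2) *\<^sub>R (hh x w + hh w x))"
    "antisymmetric_on R (\<lambda>x w. (1 / 2) *\<^sub>R (hh x w - hh w x))"
    by (simp_all add: symmetric_on_def antisymmetric_on_def add.commute scaleR_minus_right[symmetric]
        del: scaleR_minus_right)
  have f: "symmetric_on R ff" using ff_sym by (simp add: symmetric_on_def)
  have fff: "ff (ff x y) z = ff (ff y x) z \<and> ff (ff x y) z = ff (ff x z) y"
    if "x \<in> R" "y \<in> R" "z \<in> R" for x y z
  proof -
    have "ff (ff x y) z = ff z (ff y x)" using that ff_sym[of x y] ff_sym[of "ff x y" z] ff_in by simp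
    also have "\<dots> = ff y (ff z x)" using ff_ff that by simp
    also have "\<dots> = ff (ff x z) y" using that ff_sym[of x z] ff_sym[of "ff x z" y] ff_in by simp
    finally show ?thesis using ff_sym[OF that(1,2)] by simp
  qed
  \<comment> \<open>Positivity is pulled back from \<open>L\<close> along the injective isometry
    \<open>\<psi>\<close>.\<close>
  have pos: "gfh_met D p p > 0" if "p \<in> gfh_carr D" "p \<noteq> 0" for p
    using \<psi>_met[OF that(1,1)] \<psi>_zero[OF that(1)] that G.g_pos[of "\<psi> p"] \<psi>_lin
    by (auto simp: lin_on_def)
  have "fin_dim_space R"
    by (rule fin_dim_space_subspace[OF R_subspace _ G.fin_dim]) (auto simp: R_G)
  then show ?thesis
    unfolding gfh_valid_def
    using basis_D pos sym bil anti alp h hs f fff ff_bilin by (simp add: D_def)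
qed

text \<open>Coordinates along \<open>e i\<close> of two Jacobi identities: on \<open>J x\<close>,
  \<open>J w\<close>, \<open>z\<close>, in the form of \<open>ad_commute\<close>, for the first
  equation, and on \<open>J x\<close>, \<open>J w\<close>, \<open>J z\<close> for the
  second.\<close>

lemma equations_D: "gfh_equations D"
  unfolding gfh_equations_def
proof (intro allI impI ballI conjI)
  fix i x w z assume "i < dimJ D" "x \<in> ar D" "w \<in> ar D" "z \<in> ar D"
  then have i: "i < m" and R: "x \<in> R" "w \<in> R" "z \<in> R" by (simp_all add: D_simps)
  have alp: "alp D i u * B.H v (e i) = B.H (br (J u) v) (e i)" if "u \<in> R" "v \<in> B" for u v
    using ad_eigen[OF R_a[OF that(1)] that(2) i] by (simp add: D_simps)
  have hc: "hcomp D i u v = B.H (hh u v) (e i)" for u v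
    using i hh_in by (simp add: hmap_D coordJ_D)
  have 1: "alp D i x * hcomp D i w z + hcomp D i x (fmap D w z) = B.H (br (J x) (br (J w) z)) (e i)"
    if "x \<in> R" "w \<in> R" "z \<in> R" for x w z
  proof -
    have F: "ff x (ff w z) \<in> R" using ff_in that by simp
    have A: "br (J x) (hh w z) \<in> B" using ad_B hh_in that R_a by blast
    have "B.H (ff x (ff w z)) (e i) = 0"
      using R_B[OF F] i by (simp add: herm_def complex_eq_iff e_in B_J)
    then show ?thesis
      using A F hh_in[of x "ff w z"] i alp[OF that(1) hh_in]
      by (simp add: hc ad_ad[OF that] G.H_add B_G R_G e_in) (simp add: D_simps)
  qed
  show "alp D i x * hcomp D i w z - alp D i w * hcomp D i x z
      = hcomp D i w (fmap D x z) - hcomp D i x (fmap D w z)"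
    using 1[OF R] 1[OF R(2,1,3)] ad_commute[of x w z] R by (simp add: R_a algebra_simps)
  \<comment> \<open>The symmetric \<open>ff\<close> cancels in \<open>[J u, v] - [J v, u]\<close>,
    so this difference is twice \<open>halt D u v\<close>, and \<open>ad_sym\<close>
    applies.\<close>
  have halt: "br (J u) (J v) = 2 *\<^sub>R J (halt D u v)" "halt D u v \<in> B" if "u \<in> R" "v \<in> R" for u v
  proof -
    have "hh u v - hh v u = br (J u) v - br (J v) u"
      using ff_sym[OF that] hh_ff[of u v] hh_ff[of v u] by simp
    then show "br (J u) (J v) = 2 *\<^sub>R J (halt D u v)" "halt D u v \<in> B"
      using ad_sym[of u v] ad_diff_B[of u v] that
      by (simp_all add: D_simps R_a G.J_scale B_G)
  qed
  have 2: "B.H (br (J u) (br (J v) (J t))) (e i) = 2 * \<i> * (alp D i u * h2comp D i v t)"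
    if "u \<in> R" "v \<in> R" "t \<in> R" for u v t
  proof -
    have "B.H (br (J u) (br (J v) (J t))) (e i) = alp D i u * B.H (2 *\<^sub>R J (halt D v t)) (e i)"
      using halt[OF that(2,3)] that(1) by (subst alp) (auto simp: B_J)
    also have "\<dots> = 2 * \<i> * (alp D i u * h2comp D i v t)"
      using halt(2)[OF that(2,3)] i by (simp add: B.H_scale B.H_J e_in coordJ_D)
    finally show ?thesis .
  qed
  have anti: "h2comp D i z x = - h2comp D i x z"
  proof -
    have "halt D z x = - halt D x z" by (simp add: D_simps scaleR_minus_right[symmetric] del: scaleR_minus_right)
    then show ?thesis using i halt(2)[OF R(1,3)] by (simp add: coordJ_D B.H_minus e_in)
  qed
  have "B.H (br (J x) (br (J w) (J z)) + br (J w) (br (J z) (J x)) + br (J z) (br (J x) (J w))) (e i) = 0"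
    using br_jacobi[of "J x" "J w" "J z"] R i by (simp add: R_G G.H_zero B_G e_in)
  then have "2 * \<i> * wedge12 (alp D i) (h2comp D i) x w z = 0"
    using R i by (simp add: G.H_add R_G B_G e_in br_in 2 anti wedge12_def algebra_simps)
  then show "wedge12 (alp D i) (h2comp D i) x w z = 0" by simp
qed

sublocale D: gfh_space D
  by unfold_locales (rule valid_D)

text \<open>Brackets within \<open>B + R\<close> vanish. The mixed ones are the action on
  \<open>B\<close> and the splitting \<open>hh_ff\<close> on \<open>R\<close>; those within
  \<open>J R\<close> come from \<open>ad_sym\<close>.\<close>

lemma \<psi>_brk:
  assumes "p \<in> gfh_carr D" "q \<in> gfh_carr D"
  shows "\<psi> (gfh_brk D p q) = br (\<psi> p) (\<psi> q)"
proof -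
  obtain y x z y' x' z' where p: "p = (y, x, z)" "q = (y', x', z')"
    and y: "y \<in> B" "y' \<in> B" and x: "x \<in> R" "x' \<in> R" and z: "z \<in> R" "z' \<in> R"
    using assms by (cases p; cases q) (auto simp: carr_D)
  have act: "actJ D u v = br (J u) v" if "u \<in> R" "v \<in> B" for u v
  proof (rule D.aJ_eqI)
    show "actJ D u v \<in> aJ D" "br (J u) v \<in> aJ D"
      using D.actJ_in that by (simp_all add: D_simps ad_B R_a)
    fix i assume "i < dimJ D"
    then show "coordJ D i (actJ D u v) = coordJ D i (br (J u) v)"
      using that ad_eigen[OF R_a[OF that(1)] that(2)] D.coordJ_actJ[of i v u]
      by (simp add: D_simps coordJ_D ad_B R_a)
  qed
  have "cscale D (2 * \<i>) (halt D z z') = J (hh z z' - hh z' z)"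
    using hh_in by (simp add: cscale_def D_simps G.J_scale B_G)
  also have "hh z z' - hh z' z = br (J z) z' - br (J z') z"
    using ff_sym[OF z] hh_ff[of z z'] hh_ff[of z' z] by simp
  finally have 1: "cscale D (2 * \<i>) (halt D z z') = br (J z) (J z')"
    using ad_sym[of z z'] z by (simp add: R_a)
  have 2: "br (y + x) (y' + x') = 0" using x y by (simp add: a_abelian a_closed B_a R_a)
  have "br (y + x + J z) (y' + x' + J z')
      = br (y + x) (y' + x') + br (y + x) (J z') + (br (J z) (y' + x') + br (J z) (J z'))"
    using x y z by (simp only: br_add B_G R_G G.V_add G.J_in ac_simps)
  also have "br (y + x) (J z') = - br (J z') (y + x)"
    using x y z by (intro br_antisym) (simp_all add: B_G R_G)
  finally have "br (\<psi> p) (\<psi> q) = br (J z) y' + br (J z) x' - (br (J z') y + br (J z') x) + br (J z) (J z')"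
    using x y z by (simp add: p 2 br_add B_G R_G)
  also have "\<dots> = \<psi> (gfh_brk D p q)"
    unfolding hh_ff[of z x'] hh_ff[of z' x]
    using y z by (simp add: p act hmap_D D_simps(6) 1 G.J_zero)
  finally show ?thesis by simp
qed

lemma isomorphic_D: "ah_isomorphic L (gfh D)"
proof (rule ah_isomorphicI[where \<psi> = \<psi>])
  show "subspace (carr (gfh D))" "bij_betw \<psi> (carr (gfh D)) G" "lin_on (carr (gfh D)) G \<psi>"
    using carr_D_subspace \<psi>_bij \<psi>_lin by (simp_all add: gfh_def)
  show "brk (gfh D) p q \<in> carr (gfh D) \<and> \<psi> (brk (gfh D) p q) = br (\<psi> p) (\<psi> q)"
    if "p \<in> carr (gfh D)" "q \<in> carr (gfh D)" for p q
    using that D.gfh_brk_in \<psi>_brk by (simp add: gfh_def)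
  show "g (\<psi> p) (\<psi> q) = met (gfh D) p q"
    if "p \<in> carr (gfh D)" "q \<in> carr (gfh D)" for p q
    using that \<psi>_met by (simp add: gfh_def)
  show "acs (gfh D) p \<in> carr (gfh D) \<and> \<psi> (acs (gfh D) p) = J (\<psi> p)"
    if "p \<in> carr (gfh D)" for p
  proof -
    obtain y x z where p: "p = (y, x, z)" "y \<in> B" "x \<in> R" "z \<in> R"
      using \<open>p \<in> carr (gfh D)\<close> by (cases p) (auto simp: carr_D gfh_def)
    then show ?thesis
      by (simp add: gfh_def carr_D R_closed G.J_simps B_G R_G) (simp add: D_simps B_J)
  qed
qed

end

context two_step_skt
begin

lemma isomorphic_gfh:
  "\<exists>D :: ('a, 'a) gfh_data. gfh_valid D \<and> gfh_equations D \<and> ah_isomorphic L (gfh D)"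
proof -
  obtain m e a where "B.orthonormal m e"
    "\<And>x i. x \<in> \<aa> \<Longrightarrow> i < m \<Longrightarrow> br (J x) (e i) = cmul J (a i x) (e i)"
    "\<And>y. y \<in> B \<Longrightarrow> B.proj m e y = y"
  \<comment> \<open>The index set is all of \<open>\<aa>\<close>, not \<open>R\<close>, because it
    has to be closed under \<open>x \<mapsto> [J x, x]\<close>.\<close>
  proof (rule B.simultaneous_diagonalization[where S = \<aa> and A = "\<lambda>x. br (J x)" and f = "\<lambda>x. br (J x) x"])
    show "br (J x) (br (J w) y) = br (J w) (br (J x) y)" if "x \<in> \<aa>" "w \<in> \<aa>" "y \<in> B" for x w y
      using that by (simp add: ad_commute B_a)
    show "br (J x) x \<in> \<aa>" if "x \<in> \<aa>" for x
      using that by (simp add: br_in_a a_G)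
  qed (use ad_clin skt_identity in blast)+
  then interpret diagonalized_skt L m e a
    by unfold_locales
  show ?thesis using valid_D equations_D isomorphic_D by blast
qed

end

theorem proposition4p2:
  shows "(\<forall>D :: ('c::real_vector, 'v::real_vector) gfh_data.
            gfh_valid D \<and> gfh_equations D \<longrightarrow>
              almost_hermitian (gfh D) \<and> integrable_acs (gfh D))
       \<and> (\<forall>L :: 'a::real_vector ah_struct.
            skt L \<and> two_step_solvable L \<and>
            {x + acs L y |x y. x \<in> derived_alg L \<and> y \<in> derived_alg L} = carr L \<longrightarrow>
              (\<exists>D :: ('a, 'a) gfh_data.
                 gfh_valid D \<and> gfh_equations D \<and> ah_isomorphic L (gfh D)))"
  using gfh_space.gfh_almost_hermitian gfh_space.gfh_integrable two_step_skt.isomorphic_gfh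
  unfolding gfh_space_def two_step_skt_def by blast

end
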